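(* Let $\{J^kg\}_{k=0}^\infty$ be a block diagonal Carleson frame with $\sigma_p(J)\subset(0,1)$. For strictly increasing sequences $\{\lambda_k\}_{k=0}^\infty\subset[0,\infty)$, the Müntz condition $$\sum_{k=0}^\infty\frac{\lambda_k}{\lambda_k^2+1}=\infty$$ is sufficient, but not necessary, for the completeness of $\{J^{\lambda_k}g\}_{k=0}^\infty$ in $\ell^2(\mathbb N_0)$. That is: (a) if a strictly increasing sequence $\{\lambda_k\}_{k=0}^\infty\subset[0,\infty)$ satisfies the Müntz condition, then $\{J^{\lambda_k}g\}_{k=0}^\infty$ is complete in $\ell^2(\mathbb N_0)$; and (b) there exists a strictly increasing sequence $\{\lambda_k\}_{k=0}^\infty\subset[0,\infty)$ with $\sum_{k=0}^\infty\frac{\lambda_k}{\lambda_k^2+1}<\infty$ such that $\{J^{\lambda_k}g\}_{k=0}^\infty$ is complete in $\ell^2(\mathbb N_0)$.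
   Context: $\mathbb N_0=\{0,1,2,\dots\}$. Let $(n_i)_{i\ge0}$ be positive integers with $\sup_i n_i<\infty$ and $(z_i)_{i\ge0}$ complex numbers. For each $i$, $V_i\cong\mathbb C^{n_i}$ has orthonormal basis $\{\delta_{i,j}\}_{j=0}^{n_i-1}$, and $\ell^2(\mathbb N_0)$ is identified with the orthogonal direct sum $\bigoplus_iV_i$. $J_{n_i}(z_i)$ is the operator on $V_i$ with $J_{n_i}(z_i)\delta_{i,j}=z_i\delta_{i,j}+(1-|z_i|^2)\delta_{i,j+1}$ for $0\le j<n_i-1$ and $J_{n_i}(z_i)\delta_{i,n_i-1}=z_i\delta_{i,n_i-1}$. A block diagonal Carleson frame is a frame for $\ell^2(\mathbb N_0)$ of the form $\{J^kg\}_{k=0}^\infty$, where $J=\bigoplus_iJ_{n_i}(z_i)$ is a (bounded) operator on $\ell^2(\mathbb N_0)$ and $g\in\ell^2(\mathbb N_0)$; $\sigma_p(J)=\{z_i\}_{i\ge 0}$ is the point spectrum. A sequence $\{f_k\}$ in a Hilbert space $H$ is a frame for $H$ if there are $B\ge A>0$ with $A\|h\|^2\le\sum_k|\langle h,f_k\rangle|^2\le B\|h\|^2$ for all $h\in H$. A sequence is complete in $H$ if its linear span is dense in $H$. Noninteger powers: $J^\lambda=\bigoplus_iJ_{n_i}^\lambda(z_i)$, where for $z\ne0$ and $\lambda\in\mathbb C$, $J_n^\lambda(z)=\sum_{j=0}^{n-1}\binom{\lambda}{j}z^{\lambda-j}(1-|z|^2)^jM_n^j$, with $M_n$ the $n\times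 n$ matrix having ones on the subdiagonal and zeros elsewhere, $z^\lambda$ the principal branch, $\binom{\lambda}{j}=\lambda(\lambda-1)\cdots(\lambda-j+1)/j!$ and $\binom\lambda0=1$. *)

theory Defs
  imports "HOL-Analysis.Analysis" "Jordan_Normal_Form.Matrix"
begin

subsection \<open>The Hilbert space of square-summable complex sequences\<close>

definition ell2 :: "(nat \<Rightarrow> complex) set" where
  "ell2 = {h. summable (\<lambda>m. (cmod (h m))\<^sup>2)}"

definition ell2_inner :: "(nat \<Rightarrow> complex) \<Rightarrow> (nat \<Rightarrow> complex) \<Rightarrow> complex" where
  "ell2_inner h f = (\<Sum>m. h m * cnj (f m))"

definition ell2_norm :: "(nat \<Rightarrow> complex) \<Rightarrow> real" where
  "ell2_norm h = sqrt (\<Sum>m. (cmod (h m))\<^sup>2)"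

definition bounded_operator :: "((nat \<Rightarrow> complex) \<Rightarrow> nat \<Rightarrow> complex) \<Rightarrow> bool" where
  "bounded_operator T \<longleftrightarrow>
     (\<forall>h\<in>ell2. T h \<in> ell2) \<and>
     (\<forall>h\<in>ell2. \<forall>f\<in>ell2. \<forall>a b. T (\<lambda>m. a * h m + b * f m) = (\<lambda>m. a * T h m + b * T f m)) \<and>
     (\<exists>C. \<forall>h\<in>ell2. ell2_norm (T h) \<le> C * ell2_norm h)"

definition point_spectrum :: "((nat \<Rightarrow> complex) \<Rightarrow> nat \<Rightarrow> complex) \<Rightarrow> complex set" where
  "point_spectrum T = {\<mu>. \<exists>h\<in>ell2. h \<noteq> (\<lambda>m. 0) \<and> T h = (\<lambda>m. \<mu> * h m)}"

definition is_frame :: "(nat \<Rightarrow> nat \<Rightarrow> complex) \<Rightarrow> bool" where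
  "is_frame f \<longleftrightarrow>
     (\<forall>k. f k \<in> ell2) \<and>
     (\<exists>A B. 0 < A \<and> A \<le> B \<and>
        (\<forall>h\<in>ell2.
           summable (\<lambda>k. (cmod (ell2_inner h (f k)))\<^sup>2) \<and>
           A * (ell2_norm h)\<^sup>2 \<le> (\<Sum>k. (cmod (ell2_inner h (f k)))\<^sup>2) \<and>
           (\<Sum>k. (cmod (ell2_inner h (f k)))\<^sup>2) \<le> B * (ell2_norm h)\<^sup>2))"

definition linear_span :: "(nat \<Rightarrow> nat \<Rightarrow> complex) \<Rightarrow> (nat \<Rightarrow> complex) set" where
  "linear_span f = {(\<lambda>m. \<Sum>k<N. c k * f k m) | N c. True}"

definition is_complete :: "(nat \<Rightarrow> nat \<Rightarrow> complex) \<Rightarrow> bool" where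
  "is_complete f \<longleftrightarrow>
     (\<forall>k. f k \<in> ell2) \<and>
     (\<forall>h\<in>ell2. \<forall>\<epsilon>>0. \<exists>p\<in>linear_span f. ell2_norm (\<lambda>m. h m - p m) < \<epsilon>)"

subsection \<open>Block diagonal operators\<close>

text \<open>
  The space of square-summable sequences is identified with the orthogonal direct sum of
  blocks of sizes \<open>n 0, n 1, \<dots>\<close> by concatenation: block \<open>i\<close> occupies the
  coordinates \<open>block_start n i, \<dots>, block_start n (Suc i) - 1\<close>, and its basis vector
  number \<open>j\<close> is the unit vector at coordinate \<open>block_start n i + j\<close>.
  \<open>block_index n m\<close> is the block containing coordinate \<open>m\<close>; it is meaningful when
  all block sizes are positive.
\<close>

definition block_start :: "(nat \<Rightarrow> nat) \<Rightarrow> nat \<Rightarrow> nat" where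
  "block_start n i = (\<Sum>k<i. n k)"

definition block_index :: "(nat \<Rightarrow> nat) \<Rightarrow> nat \<Rightarrow> nat" where
  "block_index n m = (LEAST i. m < block_start n (Suc i))"

definition block_diag ::
  "(nat \<Rightarrow> nat) \<Rightarrow> (nat \<Rightarrow> complex mat) \<Rightarrow> (nat \<Rightarrow> complex) \<Rightarrow> nat \<Rightarrow> complex" where
  "block_diag n A h m =
     (let i = block_index n m; s = block_start n i
      in (A i *\<^sub>v vec (n i) (\<lambda>l. h (s + l))) $ (m - s))"

definition block_delta :: "(nat \<Rightarrow> nat) \<Rightarrow> nat \<Rightarrow> nat \<Rightarrow> nat \<Rightarrow> complex" where
  "block_delta n i j m = (if m = block_start n i + j then 1 else 0)"

definition sub_diag :: "nat \<Rightarrow> complex mat" where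
  "sub_diag n = mat n n (\<lambda>(r, c). if r = Suc c then 1 else 0)"

definition carleson_block :: "nat \<Rightarrow> complex \<Rightarrow> complex mat" where
  "carleson_block n z =
     mat n n (\<lambda>(r, c). if r = c then z else if r = Suc c then 1 - (of_real (cmod z))\<^sup>2 else 0)"

text \<open>For \<open>z \<noteq> 0\<close>, \<open>z powr w\<close> is the principal branch.\<close>

definition carleson_block_powr :: "nat \<Rightarrow> complex \<Rightarrow> complex \<Rightarrow> complex mat" where
  "carleson_block_powr n z w =
     mat n n (\<lambda>(r, c). \<Sum>j<n. (w gchoose j) * z powr (w - of_nat j)
        * (1 - (of_real (cmod z))\<^sup>2) ^ j * (sub_diag n ^\<^sub>m j) $$ (r, c))"

definition carleson_op ::
  "(nat \<Rightarrow> nat) \<Rightarrow> (nat \<Rightarrow> complex) \<Rightarrow> (nat \<Rightarrow> complex) \<Rightarrow> nat \<Rightarrow> complex" where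
  "carleson_op n z = block_diag n (\<lambda>i. carleson_block (n i) (z i))"

definition carleson_op_powr ::
  "(nat \<Rightarrow> nat) \<Rightarrow> (nat \<Rightarrow> complex) \<Rightarrow> complex \<Rightarrow> (nat \<Rightarrow> complex) \<Rightarrow> nat \<Rightarrow> complex" where
  "carleson_op_powr n z w = block_diag n (\<lambda>i. carleson_block_powr (n i) (z i) w)"

definition block_diagonal_carleson_frame ::
  "(nat \<Rightarrow> nat) \<Rightarrow> (nat \<Rightarrow> complex) \<Rightarrow> (nat \<Rightarrow> complex) \<Rightarrow> bool" where
  "block_diagonal_carleson_frame n z g \<longleftrightarrow>
     bounded_operator (carleson_op n z) \<and> g \<in> ell2 \<and>
     is_frame (\<lambda>k. (carleson_op n z ^^ k) g)"

text \<open>The action on the orthonormal basis, confirming the identification above.\<close>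

lemma strict_mono_block_start:
  assumes "\<And>i. 0 < n i" shows "strict_mono (block_start n)"
  using assms by (auto simp: block_start_def strict_mono_Suc_iff)

lemma block_index_eq:
  assumes "\<And>i. 0 < n i" "j < n i"
  shows "block_index n (block_start n i + j) = i"
  unfolding block_index_def
proof (rule Least_equality)
  show "block_start n i + j < block_start n (Suc i)"
    using assms by (simp add: block_start_def)
next
  fix y assume y: "block_start n i + j < block_start n (Suc y)"
  hence "block_start n i < block_start n (Suc y)" by simp
  hence "i < Suc y" using strict_mono_block_start[of n, OF assms(1)] by (simp add: strict_mono_less)
  thus "i \<le> y" by simp
qed

lemma ex_block:
  assumes "\<And>i. 0 < n i"
  obtains i j where "j < n i" "m = block_start n i + j"
proof -
  have "m \<le> block_start n m" using strict_mono_imp_increasing[OF strict_mono_block_start[of n, OF assms]] .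
  hence ex: "\<exists>i. m < block_start n (Suc i)" using assms[of m]
    by (auto simp: block_start_def intro!: exI[of _ m])
  define i where "i = (LEAST i. m < block_start n (Suc i))"
  have 1: "m < block_start n (Suc i)" unfolding i_def by (rule LeastI_ex[OF ex])
  have 2: "block_start n i \<le> m"
  proof (cases i)
    case 0 thus ?thesis by (simp add: block_start_def)
  next
    case (Suc k)
    hence "\<not> m < block_start n (Suc k)" using not_less_Least[of k "\<lambda>i. m < block_start n (Suc i)"]
      by (simp add: i_def)
    thus ?thesis using Suc by simp
  qed
  show thesis using 1 2 by (intro that[of "m - block_start n i" i]) (auto simp: block_start_def)
qed

lemma block_start_inj:
  assumes "\<And>i. 0 < n i" "j < n i" "l < n k"
  shows "block_start n i + j = block_start n k + l \<longleftrightarrow> i = k \<and> j = l"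
  using block_index_eq[of n, OF assms(1,2)] block_index_eq[of n, OF assms(1,3)] by auto

lemma carleson_op_block_delta:
  assumes pos: "\<And>i. 0 < n i" and j: "j < n i"
  shows "carleson_op n z (block_delta n i j) =
    (\<lambda>m. z i * block_delta n i j m +
         (if Suc j < n i then (1 - (of_real (cmod (z i)))\<^sup>2) * block_delta n i (Suc j) m else 0))"
proof
  fix m
  obtain k r where r: "r < n k" "m = block_start n k + r" using ex_block[of n, OF pos] .
  have d: "block_delta n i j (block_start n k + l) = (if i = k \<and> j = l then 1 else 0)"
    if "l < n k" for l
    using block_start_inj[of n, OF pos that j] by (auto simp: block_delta_def)
  have d': "block_delta n i (Suc j) (block_start n k + r) = (if i = k \<and> Suc j = r then 1 else 0)"
    if "Suc j < n i" 
    using block_start_inj[of n, OF pos r(1) that] by (auto simp: block_delta_def)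
  have "carleson_op n z (block_delta n i j) m =
     (\<Sum>l = 0..<n k. carleson_block (n k) (z k) $$ (r, l) * block_delta n i j (block_start n k + l))"
    using r block_index_eq[of n, OF pos r(1)]
    by (simp add: carleson_op_def block_diag_def Let_def scalar_prod_def carleson_block_def)
  also have "\<dots> = (\<Sum>l = 0..<n k. if l = j then
      (if i = k then carleson_block (n k) (z k) $$ (r, j) else 0) else 0)"
    by (intro sum.cong) (auto simp: d)
  also have "\<dots> = (if i = k then carleson_block (n k) (z k) $$ (r, j) else 0)"
    using j by (auto simp: sum.delta)
  also have "\<dots> = z i * block_delta n i j m +
         (if Suc j < n i then (1 - (of_real (cmod (z i)))\<^sup>2) * block_delta n i (Suc j) m else 0)"
    using r j d[OF r(1)] d' by (auto simp: carleson_block_def)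
  finally show "carleson_op n z (block_delta n i j) m = z i * block_delta n i j m +
         (if Suc j < n i then (1 - (of_real (cmod (z i)))\<^sup>2) * block_delta n i (Suc j) m else 0)" .
qed

end

theory Submission
  imports Defs "HOL-Complex_Analysis.Complex_Analysis" "HOL-Real_Asymp.Real_Asymp"
begin

text \<open>
  Write \<open>J\<close> for the operator and \<open>\<langle>h, f\<rangle>\<close> for the inner product. By the projection theorem
  (\<open>is_complete_if_orthogonal_trivial\<close>) a sequence is complete as soon as only \<open>0\<close> is orthogonal to it,
  and by the lower frame bound a vector orthogonal to all integer powers \<open>J ^ l g\<close> is \<open>0\<close>. So both
  halves reduce to one question: does orthogonality to the \<open>J ^ \<lambda> g\<close> for the given exponents \<open>\<lambda>\<close>
  imply orthogonality to \<open>J ^ l g\<close> for every natural number \<open>l\<close>?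

  The eigenvalues \<open>x i\<close> lie in \<open>(0,1)\<close>. The frame inequality, tested on one vector per block, shows
  that the gaps \<open>1 - x i\<close> are summable (\<open>frame_imp_summable_gap\<close>); in particular the \<open>x i\<close> are bounded
  below by some \<open>\<delta> > 0\<close>. On each block every function of \<open>J\<close> is a lower triangular Toeplitz matrix, that
  is, a polynomial in the nilpotent shift (\<open>block_toeplitz\<close>). Because block sizes are bounded, uniform
  bounds on the Toeplitz entries are operator norm bounds (\<open>block_toeplitz_bounded\<close>).

  Sufficiency is a uniqueness argument. The function \<open>s \<mapsto> \<langle>J ^ s g, h\<rangle>\<close> is holomorphic on
  \<open>Re s > -1\<close> and grows at most polynomially there. Moved to the unit disc by \<open>s = 2 w / (1 - w)\<close> and
  multiplied by \<open>(1 - w) ^ N\<close>, it becomes bounded. A sequence of zeros satisfying the Muentz condition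
  violates the Blaschke condition, so the function vanishes (\<open>blaschke_uniqueness\<close>, \<open>muntz_orthogonal\<close>).

  Failure of necessity is a construction that exploits how thin the spectrum is. Fix \<open>d\<close> and put
  \<open>Y = J ^ d\<close>. All blocks with \<open>1 - x i \<le> 1 / (9 d)\<close> satisfy \<open>\<parallel>1 - Y\<parallel> \<le> 1/2\<close>, and by summability of
  the gaps only \<open>O(d)\<close> blocks do not. Hence \<open>q(Y) = (1 - Y) ^ m \<Prod> (1 - Y / (x i) ^ d) ^ N\<close>, with the product over
  the exceptional blocks, vanishes on those blocks, and is small on all others for some \<open>m = O(d\<^sup>2)\<close>.
  Since \<open>q(0) = 1\<close>, the vector \<open>g\<close> is approximated by a combination of the \<open>J ^ (d k) g\<close> with
  \<open>1 \<le> k \<le> L = O(d\<^sup>2)\<close> (\<open>sparse_annihilator\<close>). The reciprocals of these exponents sum to about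
  \<open>ln L / d\<close>, which tends to zero as \<open>d\<close> grows. Shifts by \<open>l\<close> approximate \<open>J ^ l g\<close> in the same way, and a union of
  such progressions along a rapidly improving sequence of accuracies has finite total weight
  (\<open>sparse_complete_exponents\<close>).
\<close>

section \<open>Square-summable sequences\<close>

definition ell2_normsq :: "(nat \<Rightarrow> complex) \<Rightarrow> real" where
  "ell2_normsq h = (\<Sum>m. (cmod (h m))\<^sup>2)"

lemma ell2_norm_eq: "ell2_norm h = sqrt (ell2_normsq h)"
  by (simp add: ell2_norm_def ell2_normsq_def)

lemma ell2_summable: "h \<in> ell2 \<Longrightarrow> summable (\<lambda>m. (cmod (h m))\<^sup>2)"
  by (simp add: ell2_def)

lemma ell2_normsq_nonneg: "h \<in> ell2 \<Longrightarrow> 0 \<le> ell2_normsq h"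
  unfolding ell2_normsq_def by (intro suminf_nonneg ell2_summable) auto

lemma cmod_le_ell2_normsq:
  assumes "h \<in> ell2" shows "(cmod (h m))\<^sup>2 \<le> ell2_normsq h"
  unfolding ell2_normsq_def
  using sum_le_suminf[OF ell2_summable[OF assms], of "{m}"] by simp

lemma ell2_normsq_eq_0_iff:
  assumes "h \<in> ell2" shows "ell2_normsq h = 0 \<longleftrightarrow> h = (\<lambda>m. 0)"
  unfolding ell2_normsq_def using suminf_eq_zero_iff[OF ell2_summable[OF assms]]
  by auto

lemma ell2_scale: "h \<in> ell2 \<Longrightarrow> (\<lambda>m. c * h m) \<in> ell2"
  by (simp add: ell2_def norm_mult power_mult_distrib summable_mult)

lemma ell2_normsq_scale: "h \<in> ell2 \<Longrightarrow> ell2_normsq (\<lambda>m. c * h m) = (cmod c)\<^sup>2 * ell2_normsq h"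
  unfolding ell2_normsq_def
  by (simp add: norm_mult power_mult_distrib suminf_mult ell2_summable)

lemma ell2_add:
  assumes "h \<in> ell2" "f \<in> ell2" shows "(\<lambda>m. h m + f m) \<in> ell2"
proof -
  have "summable (\<lambda>m. 2 * (cmod (h m))\<^sup>2 + 2 * (cmod (f m))\<^sup>2)"
    by (intro summable_add summable_mult ell2_summable assms)
  moreover have "(cmod (h m + f m))\<^sup>2 \<le> 2 * (cmod (h m))\<^sup>2 + 2 * (cmod (f m))\<^sup>2" for m
  proof -
    have "(cmod (h m + f m))\<^sup>2 \<le> (cmod (h m) + cmod (f m))\<^sup>2"
      by (intro power_mono norm_triangle_ineq) auto
    also have "\<dots> \<le> 2 * (cmod (h m))\<^sup>2 + 2 * (cmod (f m))\<^sup>2"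
      using sum_squares_bound[of "cmod (h m)" "cmod (f m)"] by (simp add: power2_sum)
    finally show ?thesis .
  qed
  ultimately show ?thesis unfolding ell2_def mem_Collect_eq
    using summable_comparison_test'[of "\<lambda>m. 2 * (cmod (h m))\<^sup>2 + 2 * (cmod (f m))\<^sup>2" 0
        "\<lambda>m. (cmod (h m + f m))\<^sup>2"] by simp
qed

lemma ell2_diff: "h \<in> ell2 \<Longrightarrow> f \<in> ell2 \<Longrightarrow> (\<lambda>m. h m - f m) \<in> ell2"
  using ell2_add[of h "\<lambda>m. -1 * f m"] ell2_scale[of f "-1"] by simp

lemma ell2_sum:
  "(\<And>k. k \<in> K \<Longrightarrow> f k \<in> ell2) \<Longrightarrow> (\<lambda>m. \<Sum>k\<in>K. f k m) \<in> ell2"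
proof (induction K rule: infinite_finite_induct)
  case (insert x F)
  thus ?case using ell2_add[of "f x" "\<lambda>m. \<Sum>k\<in>F. f k m"] by simp
qed (simp_all add: ell2_def)

lemma summable_ell2_inner:
  assumes "h \<in> ell2" "f \<in> ell2"
  shows "summable (\<lambda>m. h m * cnj (f m))" "summable (\<lambda>m. cmod (h m) * cmod (f m))"
proof -
  have bound: "summable (\<lambda>m. (cmod (h m))\<^sup>2 + (cmod (f m))\<^sup>2)"
    by (intro summable_add ell2_summable assms)
  have le: "norm (cmod (h m) * cmod (f m)) \<le> (cmod (h m))\<^sup>2 + (cmod (f m))\<^sup>2" for m
  proof -
    have "0 \<le> cmod (h m) * cmod (f m)" by simp
    moreover have "2 * (cmod (h m) * cmod (f m)) \<le> (cmod (h m))\<^sup>2 + (cmod (f m))\<^sup>2"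
      using sum_squares_bound[of "cmod (h m)" "cmod (f m)"] by (simp add: mult.assoc)
    ultimately show ?thesis unfolding real_norm_def by linarith
  qed
  show s: "summable (\<lambda>m. cmod (h m) * cmod (f m))"
    by (rule summable_comparison_test'[OF bound le])
  show "summable (\<lambda>m. h m * cnj (f m))"
    by (rule summable_norm_cancel) (use s in \<open>simp add: norm_mult\<close>)
qed

lemma ell2_inner_add_left:
  "h \<in> ell2 \<Longrightarrow> h' \<in> ell2 \<Longrightarrow> f \<in> ell2 \<Longrightarrow>
   ell2_inner (\<lambda>m. h m + h' m) f = ell2_inner h f + ell2_inner h' f"
  unfolding ell2_inner_def by (simp add: suminf_add summable_ell2_inner ring_distribs)

lemma ell2_inner_add_right:
  "h \<in> ell2 \<Longrightarrow> f \<in> ell2 \<Longrightarrow> f' \<in> ell2 \<Longrightarrow>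
   ell2_inner h (\<lambda>m. f m + f' m) = ell2_inner h f + ell2_inner h f'"
  unfolding ell2_inner_def by (simp add: suminf_add summable_ell2_inner ring_distribs)

lemma ell2_inner_scale_right:
  "h \<in> ell2 \<Longrightarrow> f \<in> ell2 \<Longrightarrow> ell2_inner h (\<lambda>m. c * f m) = cnj c * ell2_inner h f"
  unfolding ell2_inner_def
  by (subst suminf_mult[symmetric]) (simp_all add: summable_ell2_inner mult_ac)

lemma ell2_inner_sum_right:
  "h \<in> ell2 \<Longrightarrow> (\<And>k. k \<in> K \<Longrightarrow> f k \<in> ell2) \<Longrightarrow>
   ell2_inner h (\<lambda>m. \<Sum>k\<in>K. f k m) = (\<Sum>k\<in>K. ell2_inner h (f k))"
proof (induction K rule: infinite_finite_induct)
  case (insert x F)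
  thus ?case using ell2_inner_add_right[of h "f x" "\<lambda>m. \<Sum>k\<in>F. f k m"]
    by (simp add: ell2_sum)
qed (simp_all add: ell2_inner_def)

lemma ell2_normsq_diff:
  assumes "h \<in> ell2" "f \<in> ell2"
  shows "ell2_normsq (\<lambda>m. h m - f m) = ell2_normsq h + ell2_normsq f - 2 * Re (ell2_inner h f)"
proof -
  have "(cmod (h m - f m))\<^sup>2 = (cmod (h m))\<^sup>2 + (cmod (f m))\<^sup>2 - 2 * Re (h m * cnj (f m))" for m
    by (simp only: cmod_power2) (simp add: power2_eq_square algebra_simps)
  hence "ell2_normsq (\<lambda>m. h m - f m)
      = (\<Sum>m. (cmod (h m))\<^sup>2 + (cmod (f m))\<^sup>2 - 2 * Re (h m * cnj (f m)))"
    by (simp add: ell2_normsq_def)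
  also have "\<dots> = ell2_normsq h + ell2_normsq f - 2 * Re (ell2_inner h f)"
    unfolding ell2_normsq_def ell2_inner_def
    using sums_diff[OF sums_add[OF summable_sums summable_sums] sums_mult[OF sums_Re[OF summable_sums]],
        OF ell2_summable[OF assms(1)] ell2_summable[OF assms(2)] summable_ell2_inner(1)[OF assms]]
    by (rule sums_unique[symmetric])
  finally show ?thesis .
qed

lemma ell2_parallelogram:
  assumes "h \<in> ell2" "f \<in> ell2"
  shows "ell2_normsq (\<lambda>m. h m - f m) + ell2_normsq (\<lambda>m. h m + f m)
       = 2 * ell2_normsq h + 2 * ell2_normsq f"
proof -
  have "ell2_normsq (\<lambda>m. h m + f m) = ell2_normsq (\<lambda>m. h m - (-1) * f m)" by simp
  also have "\<dots> = ell2_normsq h + ell2_normsq f + 2 * Re (ell2_inner h f)"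
    using ell2_normsq_diff[OF assms(1) ell2_scale[OF assms(2), of "-1"]]
      ell2_inner_scale_right[OF assms, of "-1"] ell2_normsq_scale[OF assms(2), of "-1"] by simp
  finally show ?thesis using ell2_normsq_diff[OF assms] by simp
qed

text \<open>Subtracting from \<open>h\<close> its component along \<open>f\<close> lowers the squared norm by exactly
  \<open>|\<langle>h, f\<rangle>|\<^sup>2 / \<parallel>f\<parallel>\<^sup>2\<close>. Both the Cauchy--Schwarz inequality and the
  orthogonality of a minimal residual are read off from this.\<close>

lemma ell2_normsq_residual:
  assumes "h \<in> ell2" "f \<in> ell2" "ell2_normsq f \<noteq> 0"
  defines "t \<equiv> ell2_inner h f / of_real (ell2_normsq f)"
  shows "ell2_normsq (\<lambda>m. h m - t * f m) * ell2_normsq f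
       = ell2_normsq h * ell2_normsq f - (cmod (ell2_inner h f))\<^sup>2"
proof -
  define N where "N = ell2_normsq f"
  define w where "w = ell2_inner h f"
  have N: "N \<noteq> 0" and t: "t = w / of_real N" using assms by (simp_all add: N_def w_def)
  have "ell2_normsq (\<lambda>m. h m - t * f m)
      = ell2_normsq h + (cmod t)\<^sup>2 * N - 2 * Re (cnj t * w)"
    using ell2_normsq_diff[OF assms(1) ell2_scale[OF assms(2), of t]]
    by (simp add: ell2_inner_scale_right[OF assms(1,2)] ell2_normsq_scale[OF assms(2)] N_def w_def)
  also have "Re (cnj t * w) = (cmod w)\<^sup>2 / N"
    by (simp only: cmod_power2)
      (simp add: t power2_eq_square Re_divide_of_real Im_divide_of_real add_divide_distrib)
  also have "(cmod t)\<^sup>2 * N = (cmod w)\<^sup>2 / N"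
    using N by (simp add: t norm_divide power_divide power2_eq_square)
  finally have "ell2_normsq (\<lambda>m. h m - t * f m) = ell2_normsq h - (cmod w)\<^sup>2 / N" by simp
  thus ?thesis using N by (simp add: N_def[symmetric] w_def[symmetric] field_simps)
qed

lemma ell2_Cauchy_Schwarz:
  assumes "h \<in> ell2" "f \<in> ell2"
  shows "(cmod (ell2_inner h f))\<^sup>2 \<le> ell2_normsq h * ell2_normsq f"
proof (cases "ell2_normsq f = 0")
  case True
  hence "f = (\<lambda>m. 0)" using assms(2) ell2_normsq_eq_0_iff by blast
  thus ?thesis by (simp add: ell2_inner_def ell2_normsq_def)
next
  case False
  define t where "t = ell2_inner h f / of_real (ell2_normsq f)"
  have "0 \<le> ell2_normsq (\<lambda>m. h m - t * f m)"
    by (intro ell2_normsq_nonneg ell2_diff ell2_scale assms)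
  hence "0 \<le> ell2_normsq (\<lambda>m. h m - t * f m) * ell2_normsq f"
    using ell2_normsq_nonneg[OF assms(2)] by simp
  thus ?thesis using ell2_normsq_residual[OF assms False] by (simp add: t_def)
qed

lemma in_linear_spanI: "p = (\<lambda>m. \<Sum>k<N. c k * f k m) \<Longrightarrow> p \<in> linear_span f"
  unfolding linear_span_def mem_Collect_eq by (rule exI[of _ N], rule exI[of _ c]) simp

lemma linear_span_add:
  assumes "p \<in> linear_span f" "q \<in> linear_span f"
  shows "(\<lambda>m. a * p m + b * q m) \<in> linear_span f"
proof -
  obtain N c where p: "p = (\<lambda>m. \<Sum>k<N. c k * f k m)" using assms(1) by (auto simp: linear_span_def)
  obtain M e where q: "q = (\<lambda>m. \<Sum>k<M. e k * f k m)" using assms(2) by (auto simp: linear_span_def)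
  have 1: "(\<Sum>k<N. c k * f k m) = (\<Sum>k<max N M. (if k < N then c k else 0) * f k m)" for m
    by (intro sum.mono_neutral_cong_left) auto
  have 2: "(\<Sum>k<M. e k * f k m) = (\<Sum>k<max N M. (if k < M then e k else 0) * f k m)" for m
    by (intro sum.mono_neutral_cong_left) auto
  have "(\<lambda>m. a * p m + b * q m) =
      (\<lambda>m. \<Sum>k<max N M. (a * (if k < N then c k else 0) + b * (if k < M then e k else 0)) * f k m)"
    unfolding p q 1 2 by (simp only: sum_distrib_left sum.distrib[symmetric] ring_distribs mult.assoc)
  thus ?thesis by (rule in_linear_spanI)
qed

lemma in_linear_span: "f k \<in> linear_span f"
proof -
  have "f k = (\<lambda>m. \<Sum>j<Suc k. (if j = k then 1 else 0) * f j m)"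
    by (rule ext) (simp add: if_distrib[of "\<lambda>x. x * _"] cong: if_cong)
  thus ?thesis by (rule in_linear_spanI)
qed

lemma linear_span_subset_ell2:
  "(\<And>k. f k \<in> ell2) \<Longrightarrow> linear_span f \<subseteq> ell2"
  unfolding linear_span_def by (auto intro!: ell2_sum ell2_scale)

text \<open>The projection theorem, in the form needed here: a minimising sequence for the distance
  from \<open>h\<close> to the span is Cauchy by the parallelogram law, and the limit of its residuals
  is orthogonal to the span because no residual can be shortened by much.\<close>

theorem is_complete_if_orthogonal_trivial:
  assumes f: "\<And>k. f k \<in> ell2"
    and triv: "\<And>u. u \<in> ell2 \<Longrightarrow> (\<And>k. ell2_inner u (f k) = 0) \<Longrightarrow> u = (\<lambda>m. 0)"
  shows "is_complete f"
  unfolding is_complete_def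
proof (intro conjI allI ballI impI f)
  fix h :: "nat \<Rightarrow> complex" and \<epsilon> :: real assume h: "h \<in> ell2" and \<epsilon>: "\<epsilon> > 0"
  note span_ell2 = subsetD[OF linear_span_subset_ell2[of f, OF f]]
  define D where "D = (\<lambda>p. ell2_normsq (\<lambda>m. h m - p m)) ` linear_span f"
  define d where "d = Inf D"
  have D_nonneg: "0 \<le> x" if "x \<in> D" for x
    proof -
    obtain p where p: "p \<in> linear_span f" and x: "x = ell2_normsq (\<lambda>m. h m - p m)"
      using \<open>x \<in> D\<close> by (auto simp: D_def)
    show ?thesis unfolding x by (rule ell2_normsq_nonneg[OF ell2_diff[OF h span_ell2[OF p]]])
  qed
  have bdd: "bdd_below D" by (rule bdd_belowI[OF D_nonneg])
  have ne: "D \<noteq> {}" using in_linear_span[of f 0] by (auto simp: D_def)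
  have d_le: "d \<le> ell2_normsq (\<lambda>m. h m - p m)" if "p \<in> linear_span f" for p
    unfolding d_def using that by (intro cInf_lower bdd) (auto simp: D_def)
  have "\<exists>p\<in>linear_span f. ell2_normsq (\<lambda>m. h m - p m) < d + 1 / real (Suc n)" for n
  proof -
    have "Inf D < d + 1 / real (Suc n)" by (simp add: d_def)
    from cInf_lessD[OF ne this] show ?thesis by (auto simp: D_def)
  qed
  then obtain p where p: "\<And>n. p n \<in> linear_span f"
    and p_lt: "\<And>n. ell2_normsq (\<lambda>m. h m - p n m) < d + 1 / real (Suc n)" by metis
  define r where "r n = (\<lambda>m. h m - p n m)" for n
  have r: "r n \<in> ell2" for n unfolding r_def by (intro ell2_diff h span_ell2 p)
  have cauchy: "ell2_normsq (\<lambda>m. r n m - r k m) \<le> 2 / real (Suc n) + 2 / real (Suc k)" for n k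
  proof -
    have "4 * d \<le> ell2_normsq (\<lambda>m. r n m + r k m)"
    proof -
      have "(\<lambda>m. (1/2) * p n m + (1/2) * p k m) \<in> linear_span f"
        by (intro linear_span_add p)
      from d_le[OF this] have "d \<le> ell2_normsq (\<lambda>m. (1/2) * (r n m + r k m))"
        by (simp add: r_def algebra_simps)
      also have "\<dots> = (1/4) * ell2_normsq (\<lambda>m. r n m + r k m)"
        by (subst ell2_normsq_scale) (auto intro: ell2_add r simp: power2_eq_square norm_divide)
      finally show ?thesis by simp
    qed
    moreover have "ell2_normsq (r n) \<le> d + 1 / real (Suc n)" for n
      using p_lt[of n] by (simp add: r_def)
    from this[of n] this[of k]
    have "2 * ell2_normsq (r n) + 2 * ell2_normsq (r k) \<le> 4 * d + (2 * (1 / real (Suc n)) + 2 * (1 / real (Suc k)))"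
      by linarith
    ultimately show ?thesis using ell2_parallelogram[OF r r, of n k] by simp
  qed
  have "Cauchy (\<lambda>n. r n m)" for m
  proof (rule CauchyI)
    fix e :: real assume e: "e > 0"
    obtain M :: nat where M: "M > 0" "4 / real M < e\<^sup>2"
    proof -
      obtain M :: nat where M: "4 / e\<^sup>2 < real M" using reals_Archimedean2 by blast
      moreover have "0 < 4 / e\<^sup>2" using e by simp
      ultimately have "real M > 0" by linarith
      thus thesis using that[of M] M e by (simp add: field_simps)
    qed
    show "\<exists>M. \<forall>n\<ge>M. \<forall>k\<ge>M. norm (r n m - r k m) < e"
    proof (intro exI allI impI)
      fix n k assume nk: "M \<le> n" "M \<le> k"
      have "(cmod (r n m - r k m))\<^sup>2 \<le> ell2_normsq (\<lambda>m. r n m - r k m)"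
        using cmod_le_ell2_normsq[OF ell2_diff[OF r r, of n k], of m] by simp
      also have "\<dots> \<le> 2 / real (Suc n) + 2 / real (Suc k)" by (rule cauchy)
      also have "\<dots> \<le> 2 / real M + 2 / real M"
        using nk M by (intro add_mono divide_left_mono) auto
      also have "\<dots> < e\<^sup>2" using M by simp
      finally show "norm (r n m - r k m) < e" using e by (simp add: power_less_imp_less_base)
    qed
  qed
  then obtain u where u: "\<And>m. (\<lambda>n. r n m) \<longlonglongrightarrow> u m"
    unfolding Cauchy_convergent_iff convergent_def by metis
  have partial: "(\<Sum>m<M. (cmod (r n m - u m))\<^sup>2) \<le> 2 / real (Suc n)" for n M
  proof -
    have "(\<lambda>k. \<Sum>m<M. (cmod (r n m - r k m))\<^sup>2) \<longlonglongrightarrow> (\<Sum>m<M. (cmod (r n m - u m))\<^sup>2)"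
      by (intro tendsto_intros u)
    moreover have "(\<lambda>k. 2 / real (Suc n) + 2 / real (Suc k)) \<longlonglongrightarrow> 2 / real (Suc n) + 0"
      by (intro tendsto_add tendsto_const LIMSEQ_Suc lim_const_over_n)
    moreover have "(\<Sum>m<M. (cmod (r n m - r k m))\<^sup>2) \<le> 2 / real (Suc n) + 2 / real (Suc k)" for k
      using cauchy[of n k] sum_le_suminf[OF ell2_summable[OF ell2_diff[OF r r, of n k]], of "{..<M}"]
      by (simp add: ell2_normsq_def)
    ultimately show ?thesis using LIMSEQ_le by fastforce
  qed
  have diff_ell2: "(\<lambda>m. r n m - u m) \<in> ell2" for n
    unfolding ell2_def mem_Collect_eq by (rule summableI_nonneg_bounded[OF _ partial]) auto
  have diff_le: "ell2_normsq (\<lambda>m. r n m - u m) \<le> 2 / real (Suc n)" for n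
    unfolding ell2_normsq_def
    by (intro suminf_le_const partial ell2_summable[OF diff_ell2])
  have u_ell2: "u \<in> ell2" using ell2_diff[OF r diff_ell2, of 0 0] by simp
  have "ell2_inner u (f k) = 0" for k
  proof (cases "ell2_normsq (f k) = 0")
    case True
    hence "f k = (\<lambda>m. 0)" using f ell2_normsq_eq_0_iff by blast
    thus ?thesis by (simp add: ell2_inner_def)
  next
    case False
    define N where "N = ell2_normsq (f k)"
    have N: "N > 0" using False ell2_normsq_nonneg[OF f, of k] by (simp add: N_def)
    have res: "(cmod (ell2_inner (r n) (f k)))\<^sup>2 \<le> N / real (Suc n)" for n
    proof -
      define t where "t = ell2_inner (r n) (f k) / of_real (ell2_normsq (f k))"
      have "(\<lambda>m. 1 * p n m + t * f k m) \<in> linear_span f"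
        by (intro linear_span_add p in_linear_span)
      from d_le[OF this] have "d \<le> ell2_normsq (\<lambda>m. r n m - t * f k m)"
        by (simp add: r_def algebra_simps)
      hence "d * N \<le> ell2_normsq (\<lambda>m. r n m - t * f k m) * N" using N by simp
      also have "\<dots> = ell2_normsq (r n) * N - (cmod (ell2_inner (r n) (f k)))\<^sup>2"
        using ell2_normsq_residual[OF r f False, of n] by (simp add: N_def t_def)
      finally have "(cmod (ell2_inner (r n) (f k)))\<^sup>2 \<le> (ell2_normsq (r n) - d) * N"
        by (simp add: algebra_simps)
      also have "\<dots> \<le> (1 / real (Suc n)) * N"
        using p_lt[of n] N by (intro mult_right_mono) (simp_all add: r_def)
      finally show ?thesis by simp
    qed
    have "(cmod (ell2_inner u (f k)))\<^sup>2 \<le> 6 * N / real (Suc n)" for n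
    proof -
      have "ell2_inner (r n) (f k) = ell2_inner u (f k) + ell2_inner (\<lambda>m. r n m - u m) (f k)"
        using ell2_inner_add_left[OF u_ell2 diff_ell2 f, of n k] by simp
      hence "cmod (ell2_inner u (f k)) \<le> cmod (ell2_inner (r n) (f k)) + cmod (ell2_inner (\<lambda>m. r n m - u m) (f k))"
        by (metis add_diff_cancel_right' norm_triangle_ineq4)
      hence "(cmod (ell2_inner u (f k)))\<^sup>2
          \<le> (cmod (ell2_inner (r n) (f k)) + cmod (ell2_inner (\<lambda>m. r n m - u m) (f k)))\<^sup>2"
        by (intro power_mono) auto
      also have "\<dots> \<le> 2 * (cmod (ell2_inner (r n) (f k)))\<^sup>2
            + 2 * (cmod (ell2_inner (\<lambda>m. r n m - u m) (f k)))\<^sup>2"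
        using sum_squares_bound[of "cmod (ell2_inner (r n) (f k))" "cmod (ell2_inner (\<lambda>m. r n m - u m) (f k))"]
        by (simp add: power2_sum)
      also have "\<dots> \<le> 2 * (N / real (Suc n)) + 2 * ((2 / real (Suc n)) * N)"
      proof -
        have "(cmod (ell2_inner (\<lambda>m. r n m - u m) (f k)))\<^sup>2 \<le> (2 / real (Suc n)) * N"
          using ell2_Cauchy_Schwarz[OF diff_ell2 f, of n k] mult_right_mono[OF diff_le[of n], of N] N
          by (simp add: N_def)
        thus ?thesis using res[of n] by simp
      qed
      also have "\<dots> = 6 * N / real (Suc n)"
        by (simp add: divide_inverse algebra_simps del: of_nat_Suc)
      finally show ?thesis .
    qed
    moreover have "(\<lambda>n. 6 * N / real (Suc n)) \<longlonglongrightarrow> 0"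
      by (rule LIMSEQ_Suc[OF lim_const_over_n])
    ultimately have "(cmod (ell2_inner u (f k)))\<^sup>2 \<le> 0"
      by (intro LIMSEQ_le_const) auto
    thus ?thesis by simp
  qed
  hence u0: "u = (\<lambda>m. 0)" by (rule triv[OF u_ell2])
  obtain n :: nat where "2 / \<epsilon>\<^sup>2 < real n" using reals_Archimedean2 by blast
  hence n: "2 / \<epsilon>\<^sup>2 < real (Suc n)" by simp
  have "ell2_normsq (r n) < \<epsilon>\<^sup>2"
  proof -
    have "ell2_normsq (r n) \<le> 2 / real (Suc n)" using diff_le[of n] by (simp add: u0)
    also have "\<dots> < \<epsilon>\<^sup>2" using n \<epsilon> by (simp add: field_simps)
    finally show ?thesis .
  qed
  hence "ell2_norm (r n) < \<epsilon>"
    unfolding ell2_norm_eq using \<epsilon> by (simp add: real_less_lsqrt)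
  thus "\<exists>p\<in>linear_span f. ell2_norm (\<lambda>m. h m - p m) < \<epsilon>"
    using p[of n] by (auto simp: r_def)
qed

section \<open>Zeros of bounded holomorphic functions on the disc\<close>

lemma blaschke_factor_in_disc:
  fixes a u :: complex
  assumes "cmod a < 1" "cmod u < 1"
  shows "cmod ((u - a) / (1 - cnj a * u)) < 1"
    and "1 - cnj a * u \<noteq> 0"
    and "(cmod ((u - a) / (1 - cnj a * u)))\<^sup>2
       = 1 - (1 - (cmod a)\<^sup>2) * (1 - (cmod u)\<^sup>2) / (cmod (1 - cnj a * u))\<^sup>2"
proof -
  have "cmod (cnj a * u) < 1 * 1" unfolding norm_mult
    using assms by (intro mult_strict_mono') auto
  thus ne: "1 - cnj a * u \<noteq> 0" by auto
  have "(cmod (1 - cnj a * u))\<^sup>2 - (cmod (u - a))\<^sup>2 = (1 - (cmod a)\<^sup>2) * (1 - (cmod u)\<^sup>2)"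
    by (simp only: cmod_power2) (simp add: power2_eq_square algebra_simps)
  thus eq: "(cmod ((u - a) / (1 - cnj a * u)))\<^sup>2
       = 1 - (1 - (cmod a)\<^sup>2) * (1 - (cmod u)\<^sup>2) / (cmod (1 - cnj a * u))\<^sup>2"
    using ne by (simp add: norm_divide power_divide field_simps)
  have "0 < (1 - (cmod a)\<^sup>2) * (1 - (cmod u)\<^sup>2) / (cmod (1 - cnj a * u))\<^sup>2"
    using assms ne by (intro divide_pos_pos mult_pos_pos) (auto simp: power_less_one_iff)
  hence "(cmod ((u - a) / (1 - cnj a * u)))\<^sup>2 < 1\<^sup>2" using eq by simp
  thus "cmod ((u - a) / (1 - cnj a * u)) < 1" by (rule power_less_imp_less_base) simp
qed

text \<open>Schwarz's lemma, transported to the point \<open>a\<close> by a disc automorphism: a zero at \<open>a\<close>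
  can be divided out by its Blaschke factor at no cost in the sup norm.\<close>

lemma divide_out_blaschke_factor:
  assumes hol: "f holomorphic_on ball 0 1" and bound: "\<And>u. cmod u < 1 \<Longrightarrow> cmod (f u) \<le> M"
    and a: "cmod a < 1" "f a = 0"
  obtains g where "g holomorphic_on ball 0 1" "\<And>u. cmod u < 1 \<Longrightarrow> cmod (g u) \<le> M"
    "\<And>u. cmod u < 1 \<Longrightarrow> f u = (u - a) / (1 - cnj a * u) * g u"
proof -
  define \<phi> where "\<phi> u = (u - a) / (1 - cnj a * u)" for u
  define \<psi> where "\<psi> u = (u + a) / (1 + cnj a * u)" for u
  have \<phi>: "cmod (\<phi> u) < 1" if "cmod u < 1" for u
    using blaschke_factor_in_disc(1)[OF a(1) that] by (simp add: \<phi>_def)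
  have \<psi>: "cmod (\<psi> u) < 1" if "cmod u < 1" for u
    using blaschke_factor_in_disc(1)[of "-a" u] a that by (simp add: \<psi>_def)
  have ne1: "1 - cnj a * u \<noteq> 0" if "cmod u < 1" for u
    using blaschke_factor_in_disc(2)[OF a(1) that] .
  have ne2: "1 + cnj a * u \<noteq> 0" if "cmod u < 1" for u
    using blaschke_factor_in_disc(2)[of "-a" u] a that by simp
  have hol_\<phi>: "\<phi> holomorphic_on ball 0 1"
    unfolding \<phi>_def by (intro holomorphic_intros) (use ne1 in auto)
  have hol_\<psi>: "\<psi> holomorphic_on ball 0 1"
    unfolding \<psi>_def by (intro holomorphic_intros) (use ne2 in auto)
  have inv: "\<psi> (\<phi> u) = u" if "cmod u < 1" for u
  proof -
    have n1: "1 - cnj a * u \<noteq> 0" by (rule ne1[OF that])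
    have n2: "1 + cnj a * ((u - a) / (1 - cnj a * u)) \<noteq> 0"
      using ne2[OF \<phi>[OF that]] by (simp add: \<phi>_def)
    have n3: "1 - cnj a * a \<noteq> 0" using ne1[OF a(1)] .
    have num: "(u - a) / (1 - cnj a * u) + a = u * (1 - cnj a * a) / (1 - cnj a * u)"
      using n1 by (simp add: divide_simps) (simp add: algebra_simps)
    have den: "1 + cnj a * ((u - a) / (1 - cnj a * u)) = (1 - cnj a * a) / (1 - cnj a * u)"
      using n1 by (simp add: divide_simps) (simp add: algebra_simps)
    show ?thesis unfolding \<psi>_def \<phi>_def num den using n1 n3 by simp
  qed
  have hol_f\<psi>: "(\<lambda>u. f (\<psi> u)) holomorphic_on ball 0 1"
    using holomorphic_on_compose_gen[OF hol_\<psi> hol] \<psi> by (simp add: o_def image_subset_iff)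
  have z: "f (\<psi> 0) = 0" using a by (simp add: \<psi>_def)
  obtain h where h: "h holomorphic_on ball 0 1"
      "\<And>u. cmod u < 1 \<Longrightarrow> f (\<psi> u) = u * h u" "deriv (\<lambda>u. f (\<psi> u)) 0 = h 0"
    using Schwarz3[OF hol_f\<psi> z] by blast
  have M: "0 \<le> M" using bound[of 0] norm_ge_zero[of "f 0"] by (simp del: norm_ge_zero)
  have h_le: "cmod (h u) \<le> M" if u: "cmod u < 1" for u
  proof (rule field_le_epsilon)
    fix e :: real assume e: "e > 0"
    define F where "F u = f (\<psi> u) / of_real (M + e)" for u
    have pos: "0 < M + e" using M e by simp
    have F: "F holomorphic_on ball 0 1" unfolding F_def
      by (intro holomorphic_intros hol_f\<psi>) (use pos in \<open>auto simp: complex_eq_iff\<close>)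
    have F0: "F 0 = 0" using z by (simp add: F_def)
    have Fb: "cmod (F u) < 1" if "cmod u < 1" for u
      using bound[OF \<psi>[OF that]] e pos by (simp add: F_def norm_divide del: of_real_add)
    have dF: "deriv F 0 = h 0 / of_real (M + e)"
      unfolding F_def h(3)[symmetric]
      by (rule deriv_cdivide_right)
        (rule holomorphic_on_imp_differentiable_at[OF hol_f\<psi>], auto)
    have "cmod (h u / of_real (M + e)) \<le> 1"
    proof (cases "u = 0")
      case True
      thus ?thesis using Schwarz_Lemma(2)[OF F F0 Fb u] dF by simp
    next
      case False
      have "cmod u * cmod (h u / of_real (M + e)) \<le> cmod u"
        using Schwarz_Lemma(1)[OF F F0 Fb u] h(2)[OF u] by (simp add: F_def norm_mult norm_divide)
      thus ?thesis using False by simp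
    qed
    thus "cmod (h u) \<le> M + e" using pos by (simp add: norm_divide del: of_real_add)
  qed
  show thesis
  proof (rule that[of "\<lambda>u. h (\<phi> u)"])
    show "(\<lambda>u. h (\<phi> u)) holomorphic_on ball 0 1"
      using holomorphic_on_compose_gen[OF hol_\<phi> h(1)] \<phi> by (simp add: o_def image_subset_iff)
  next
    fix u :: complex assume u: "cmod u < 1"
    show "cmod (h (\<phi> u)) \<le> M" by (rule h_le[OF \<phi>[OF u]])
    show "f u = (u - a) / (1 - cnj a * u) * h (\<phi> u)"
      using h(2)[OF \<phi>[OF u]] inv[OF u] by (simp add: \<phi>_def)
  qed
qed

text \<open>The zeros must be distinct: only then does \<open>a n\<close> remain a zero after the factors of
  \<open>a 0, \<dots>, a (n - 1)\<close> have been divided out.\<close>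

lemma divide_out_blaschke_product:
  fixes a :: "nat \<Rightarrow> complex"
  assumes "f holomorphic_on ball 0 1" and "\<And>u. cmod u < 1 \<Longrightarrow> cmod (f u) \<le> M"
    and "\<And>k. cmod (a k) < 1" "\<And>k. f (a k) = 0" "inj a"
  shows "\<exists>g. g holomorphic_on ball 0 1 \<and> (\<forall>u. cmod u < 1 \<longrightarrow> cmod (g u) \<le> M) \<and>
    (\<forall>u. cmod u < 1 \<longrightarrow> f u = (\<Prod>k<n. (u - a k) / (1 - cnj (a k) * u)) * g u)"
proof (induction n)
  case 0
  show ?case using assms by (intro exI[of _ f]) auto
next
  case (Suc n)
  then obtain g where g: "g holomorphic_on ball 0 1" "\<And>u. cmod u < 1 \<Longrightarrow> cmod (g u) \<le> M"
    "\<And>u. cmod u < 1 \<Longrightarrow> f u = (\<Prod>k<n. (u - a k) / (1 - cnj (a k) * u)) * g u" by blast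
  have "(\<Prod>k<n. (a n - a k) / (1 - cnj (a k) * a n)) \<noteq> 0"
    using blaschke_factor_in_disc(2)[OF assms(3) assms(3)] \<open>inj a\<close>
    by (auto simp: inj_eq)
  hence "g (a n) = 0" using g(3)[OF assms(3), of n] assms(4)[of n] by simp
  from divide_out_blaschke_factor[OF g(1,2) assms(3) this]
  obtain h where h: "h holomorphic_on ball 0 1" "\<And>u. cmod u < 1 \<Longrightarrow> cmod (h u) \<le> M"
    "\<And>u. cmod u < 1 \<Longrightarrow> g u = (u - a n) / (1 - cnj (a n) * u) * h u" by blast
  show ?case using h g(3) by (intro exI[of _ h]) (auto simp: mult.assoc)
qed

text \<open>Blaschke's uniqueness theorem. Each Blaschke factor has modulus at most
  \<open>exp (- c (1 - |a|))\<close> at \<open>u\<close>, with \<open>c\<close> depending on \<open>u\<close> only, so a divergent sum of the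
  \<open>1 - |a k|\<close> drives the product to zero.\<close>

theorem blaschke_uniqueness:
  fixes a :: "nat \<Rightarrow> complex"
  assumes hol: "f holomorphic_on ball 0 1" and bound: "\<And>u. cmod u < 1 \<Longrightarrow> cmod (f u) \<le> M"
    and a: "\<And>k. cmod (a k) < 1" "\<And>k. f (a k) = 0" "inj a"
    and div: "\<not> summable (\<lambda>k. 1 - cmod (a k))" and u: "cmod u < 1"
  shows "f u = 0"
proof (rule ccontr)
  assume nz: "f u \<noteq> 0"
  define c where "c = (1 - (cmod u)\<^sup>2) / 4"
  have c: "c > 0" using u by (simp add: c_def power_less_one_iff)
  have factor: "(cmod ((u - a k) / (1 - cnj (a k) * u)))\<^sup>2 \<le> exp (- c * (1 - cmod (a k)))" for k
  proof -
    define A where "A = cmod (a k)"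
    have A: "0 \<le> A" "A < 1" using a(1) by (auto simp: A_def)
    have den: "0 < cmod (1 - cnj (a k) * u)" "cmod (1 - cnj (a k) * u) \<le> 2"
    proof -
      show "0 < cmod (1 - cnj (a k) * u)" using blaschke_factor_in_disc(2)[OF a(1) u] by simp
      have "cmod (cnj (a k) * u) \<le> 1 * 1" unfolding norm_mult
        using a(1)[of k] u by (intro mult_mono) auto
      thus "cmod (1 - cnj (a k) * u) \<le> 2"
        using norm_triangle_ineq4[of 1 "cnj (a k) * u"] by simp
    qed
    have "c * (1 - A) = (1 - A) * (1 - (cmod u)\<^sup>2) / 2\<^sup>2" by (simp add: c_def)
    also have "\<dots> \<le> (1 - A\<^sup>2) * (1 - (cmod u)\<^sup>2) / 2\<^sup>2"
    proof -
      have "A\<^sup>2 \<le> A" using A by (simp add: power2_eq_square mult_left_le)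
      moreover have "(cmod u)\<^sup>2 \<le> 1" using u by (simp add: power_le_one)
      ultimately show ?thesis by (intro divide_right_mono mult_right_mono) auto
    qed
    also have "\<dots> \<le> (1 - A\<^sup>2) * (1 - (cmod u)\<^sup>2) / (cmod (1 - cnj (a k) * u))\<^sup>2"
      using den A u by (intro divide_left_mono power_mono mult_nonneg_nonneg mult_pos_pos) (auto simp: power_le_one)
    finally have "(cmod ((u - a k) / (1 - cnj (a k) * u)))\<^sup>2 \<le> 1 + - (c * (1 - A))"
      using blaschke_factor_in_disc(3)[OF a(1) u, of k] by (simp add: A_def)
    also have "\<dots> \<le> exp (- (c * (1 - A)))" by (rule exp_ge_add_one_self)
    finally show ?thesis by (simp add: A_def)
  qed
  have M: "0 < M" using bound[OF u] nz by (smt (verit) zero_less_norm_iff)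
  have upper: "(cmod (f u))\<^sup>2 \<le> exp (- c * (\<Sum>k<n. 1 - cmod (a k))) * M\<^sup>2" for n
  proof -
    obtain g where g: "\<And>u. cmod u < 1 \<Longrightarrow> cmod (g u) \<le> M"
      "\<And>u. cmod u < 1 \<Longrightarrow> f u = (\<Prod>k<n. (u - a k) / (1 - cnj (a k) * u)) * g u"
      using divide_out_blaschke_product[OF hol bound a, of n] by blast
    have "(cmod (f u))\<^sup>2 = (\<Prod>k<n. (cmod ((u - a k) / (1 - cnj (a k) * u)))\<^sup>2) * (cmod (g u))\<^sup>2"
      unfolding g(2)[OF u] by (simp only: norm_mult power_mult_distrib prod_norm[symmetric] prod_power_distrib)
    also have "\<dots> \<le> (\<Prod>k<n. exp (- c * (1 - cmod (a k)))) * M\<^sup>2"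
      using factor g(1)[OF u] by (intro mult_mono prod_mono power_mono prod_nonneg conjI) auto
    also have "(\<Prod>k<n. exp (- c * (1 - cmod (a k)))) = exp (- c * (\<Sum>k<n. 1 - cmod (a k)))"
      by (simp only: exp_sum[symmetric] sum_distrib_left finite_lessThan)
    finally show ?thesis .
  qed
  define B where "B = ln (M\<^sup>2 / (cmod (f u))\<^sup>2) / c"
  have "(\<Sum>k<n. 1 - cmod (a k)) \<le> B" for n
  proof -
    define S where "S = (\<Sum>k<n. 1 - cmod (a k))"
    have "exp (c * S) * (cmod (f u))\<^sup>2 \<le> exp (c * S) * (exp (- c * S) * M\<^sup>2)"
      using upper[of n] by (intro mult_left_mono) (auto simp: S_def)
    also have "\<dots> = M\<^sup>2" by (simp add: mult.assoc[symmetric] exp_add[symmetric])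
    finally have "exp (c * S) \<le> M\<^sup>2 / (cmod (f u))\<^sup>2" using nz by (simp add: field_simps)
    hence "c * S \<le> ln (M\<^sup>2 / (cmod (f u))\<^sup>2)" using M nz by (subst ln_ge_iff) auto
    thus ?thesis using c by (simp add: B_def S_def[symmetric] field_simps)
  qed
  hence "summable (\<lambda>k. 1 - cmod (a k))"
    using a(1) by (intro summableI_nonneg_bounded[of _ B]) (auto simp: less_imp_le)
  thus False using div by contradiction
qed

section \<open>Block Toeplitz operators\<close>

definition block_offset :: "(nat \<Rightarrow> nat) \<Rightarrow> nat \<Rightarrow> nat" where
  "block_offset n m = m - block_start n (block_index n m)"

text \<open>On block \<open>i\<close> this is the lower triangular Toeplitz matrix \<open>\<Sum>j. c i j * M ^ j\<close>, with \<open>M\<close>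
  the subdiagonal shift.\<close>

definition block_toeplitz ::
  "(nat \<Rightarrow> nat) \<Rightarrow> (nat \<Rightarrow> nat \<Rightarrow> complex) \<Rightarrow> (nat \<Rightarrow> complex) \<Rightarrow> nat \<Rightarrow> complex" where
  "block_toeplitz n c h m = (\<Sum>j\<le>block_offset n m. c (block_index n m) j * h (m - j))"

lemma block_decomposition:
  assumes "\<And>i. 0 < n i"
  shows "block_offset n m < n (block_index n m)"
    and "m = block_start n (block_index n m) + block_offset n m"
proof -
  obtain i j where ij: "j < n i" "m = block_start n i + j" using ex_block[of n, OF assms] .
  hence "block_index n m = i" using block_index_eq[of n, OF assms ij(1)] by simp
  thus "block_offset n m < n (block_index n m)"
    and "m = block_start n (block_index n m) + block_offset n m"
    using ij by (auto simp: block_offset_def)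
qed

lemma block_shift:
  assumes "\<And>i. 0 < n i" "j \<le> block_offset n m"
  shows "block_index n (m - j) = block_index n m" "block_offset n (m - j) = block_offset n m - j" "j \<le> m"
proof -
  let ?i = "block_index n m"
  have m: "m = block_start n ?i + block_offset n m" "block_offset n m < n ?i"
    using block_decomposition[of n, OF assms(1)] by auto
  have eq: "m - j = block_start n ?i + (block_offset n m - j)" using m(1) assms(2) by linarith
  have lt: "block_offset n m - j < n ?i" using m(2) by simp
  show idx: "block_index n (m - j) = ?i"
    unfolding eq using block_index_eq[of n, OF assms(1) lt] .
  show "block_offset n (m - j) = block_offset n m - j"
    unfolding block_offset_def[of n "m - j"] idx using eq by simp
  show "j \<le> m" using m(1) assms(2) by linarith
qed

lemma block_diag_toeplitz:
  assumes pos: "\<And>i. 0 < n i" and dim: "\<And>i. A i \<in> carrier_mat (n i) (n i)"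
    and entry: "\<And>i r l. r < n i \<Longrightarrow> l < n i \<Longrightarrow> A i $$ (r, l) = (if l \<le> r then c i (r - l) else 0)"
  shows "block_diag n A h = block_toeplitz n c h"
proof (rule ext)
  fix m
  define i r where "i = block_index n m" and "r = block_offset n m"
  define s where "s = block_start n i"
  have r: "r < n i" "m = s + r" using block_decomposition[of n m, OF pos] by (auto simp: i_def r_def s_def)
  have d: "dim_row (A i) = n i" "dim_col (A i) = n i" using dim[of i] by auto
  have "block_diag n A h m = (A i *\<^sub>v vec (n i) (\<lambda>l. h (s + l))) $ r"
    by (simp add: block_diag_def Let_def i_def r_def s_def block_offset_def)
  also have "\<dots> = (\<Sum>l = 0..<n i. A i $$ (r, l) * h (s + l))"
    using r(1) d by (simp add: scalar_prod_def)
  also have "\<dots> = (\<Sum>l = 0..<n i. (if l \<le> r then c i (r - l) else 0) * h (s + l))"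
    using r(1) by (intro sum.cong) (auto simp: entry)
  also have "\<dots> = (\<Sum>l\<le>r. c i (r - l) * h (s + l))"
    using r(1) by (intro sum.mono_neutral_cong_right) auto
  also have "\<dots> = (\<Sum>j\<le>r. c i j * h (m - j))"
    by (rule sum.reindex_bij_witness[of _ "\<lambda>j. r - j" "\<lambda>j. r - j"]) (auto simp: r(2))
  finally show "block_diag n A h m = block_toeplitz n c h m"
    by (simp add: block_toeplitz_def i_def r_def)
qed

lemma sub_diag_power:
  assumes "r < k" "l < k"
  shows "(sub_diag k ^\<^sub>m j) $$ (r, l) = (if r = l + j then 1 else 0)"
  using assms
proof (induction j arbitrary: l)
  case (Suc j)
  have dim: "sub_diag k ^\<^sub>m j \<in> carrier_mat k k" by (intro pow_carrier_mat) (simp add: sub_diag_def)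
  hence d: "dim_row (sub_diag k ^\<^sub>m j) = k" "dim_col (sub_diag k ^\<^sub>m j) = k" by auto
  have "(sub_diag k ^\<^sub>m Suc j) $$ (r, l)
      = (\<Sum>i = 0..<k. (sub_diag k ^\<^sub>m j) $$ (r, i) * (if i = Suc l then 1 else 0))"
    using Suc.prems d by (simp add: scalar_prod_def sub_diag_def)
  also have "\<dots> = (\<Sum>i = 0..<k. if i = Suc l then (if r = i + j then 1 else 0) else 0)"
    by (intro sum.cong) (use Suc in auto)
  also have "\<dots> = (if r = l + Suc j then 1 else 0)"
    using Suc.prems by (auto simp: sum.delta)
  finally show ?case .
qed (simp add: sub_diag_def)

definition carleson_powr_coeff :: "complex \<Rightarrow> complex \<Rightarrow> nat \<Rightarrow> complex" where
  "carleson_powr_coeff w \<zeta> j =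
     (w gchoose j) * \<zeta> powr (w - of_nat j) * (1 - (of_real (cmod \<zeta>))\<^sup>2) ^ j"

definition carleson_symbol :: "complex \<Rightarrow> complex poly" where
  "carleson_symbol \<zeta> = [:\<zeta>, 1 - (of_real (cmod \<zeta>))\<^sup>2:]"

lemma carleson_op_powr_toeplitz:
  assumes "\<And>i. 0 < n i"
  shows "carleson_op_powr n z w h = block_toeplitz n (\<lambda>i. carleson_powr_coeff w (z i)) h"
  unfolding carleson_op_powr_def
proof (rule block_diag_toeplitz[OF assms])
  show "carleson_block_powr (n i) (z i) w \<in> carrier_mat (n i) (n i)" for i
    by (simp add: carleson_block_powr_def)
  fix i r l assume rl: "r < n i" "l < n i"
  have "carleson_block_powr (n i) (z i) w $$ (r, l)
      = (\<Sum>j<n i. if j = r - l then (if l \<le> r then carleson_powr_coeff w (z i) j else 0) else 0)"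
    using rl unfolding carleson_block_powr_def index_mat(1)[OF rl] case_prod_conv
    by (intro sum.cong) (auto simp: sub_diag_power carleson_powr_coeff_def)
  also have "\<dots> = (if l \<le> r then carleson_powr_coeff w (z i) (r - l) else 0)"
    using rl by (auto simp: sum.delta)
  finally show "carleson_block_powr (n i) (z i) w $$ (r, l)
      = (if l \<le> r then carleson_powr_coeff w (z i) (r - l) else 0)" .
qed

lemma carleson_op_toeplitz:
  assumes "\<And>i. 0 < n i"
  shows "carleson_op n z h = block_toeplitz n (\<lambda>i. coeff (carleson_symbol (z i))) h"
  unfolding carleson_op_def
  by (rule block_diag_toeplitz[OF assms])
    (auto simp: carleson_block_def carleson_symbol_def coeff_pCons split: nat.split)

text \<open>Lower triangular Toeplitz matrices multiply like polynomials in the shift.\<close>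

lemma block_toeplitz_mult:
  assumes pos: "\<And>i. 0 < n i"
  shows "block_toeplitz n (\<lambda>i. coeff (P i)) (block_toeplitz n (\<lambda>i. coeff (Q i)) h)
       = block_toeplitz n (\<lambda>i. coeff (P i * Q i)) h"
proof (rule ext)
  fix m
  define i r where "i = block_index n m" and "r = block_offset n m"
  define g where "g j l = coeff (P i) j * (coeff (Q i) l * h (m - (j + l)))" for j l
  have "block_toeplitz n (\<lambda>i. coeff (P i)) (block_toeplitz n (\<lambda>i. coeff (Q i)) h) m
      = (\<Sum>j\<le>r. coeff (P i) j * (\<Sum>l\<le>r - j. coeff (Q i) l * h (m - j - l)))"
    unfolding block_toeplitz_def i_def r_def
    by (intro sum.cong refl) (simp add: block_shift[of n, OF pos])
  also have "\<dots> = (\<Sum>j\<le>r. \<Sum>l\<le>r - j. g j l)"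
    by (simp add: sum_distrib_left g_def)
  also have "\<dots> = (\<Sum>(j, l)\<in>{(j, l). j + l \<le> r}. g j l)"
    by (subst sum.Sigma) (auto intro!: sum.cong)
  also have "\<dots> = (\<Sum>k\<le>r. \<Sum>j\<le>k. g j (k - j))"
    by (rule sum.triangle_reindex_eq)
  also have "\<dots> = (\<Sum>k\<le>r. coeff (P i * Q i) k * h (m - k))"
    by (intro sum.cong refl) (simp add: coeff_mult sum_distrib_right g_def mult.assoc)
  finally show "block_toeplitz n (\<lambda>i. coeff (P i)) (block_toeplitz n (\<lambda>i. coeff (Q i)) h) m
      = block_toeplitz n (\<lambda>i. coeff (P i * Q i)) h m"
    by (simp add: block_toeplitz_def i_def r_def)
qed

lemma carleson_op_funpow:
  assumes "\<And>i. 0 < n i"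
  shows "(carleson_op n z ^^ k) h = block_toeplitz n (\<lambda>i. coeff (carleson_symbol (z i) ^ k)) h"
proof (induction k)
  case 0
  have "(\<Sum>j\<le>r. coeff 1 j * h (m - j)) = h m" for r m :: nat
  proof -
    have "(\<Sum>j\<le>r. coeff 1 j * h (m - j)) = (\<Sum>j\<le>r. if j = 0 then h m else 0)"
      by (intro sum.cong) (auto simp: coeff_1)
    thus ?thesis by simp
  qed
  thus ?case by (simp add: block_toeplitz_def fun_eq_iff)
next
  case (Suc k)
  thus ?case by (simp add: carleson_op_toeplitz[OF assms] block_toeplitz_mult[OF assms])
qed

text \<open>The two descriptions of integer powers agree by the binomial theorem; for \<open>k < j\<close> the
  generalised binomial coefficient vanishes.\<close>

lemma carleson_op_powr_of_nat:
  assumes "\<And>i. 0 < n i" "\<And>i. z i \<noteq> 0"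
  shows "carleson_op_powr n z (of_nat k) h = (carleson_op n z ^^ k) h"
proof -
  have "carleson_powr_coeff (of_nat k) (z i) j = coeff (carleson_symbol (z i) ^ k) j" for i j
  proof (cases "j \<le> k")
    case True
    have "z i powr (of_nat k - of_nat j) = z i ^ (k - j)"
      using True assms(2) by (simp add: of_nat_diff[symmetric] powr_nat' del: of_nat_diff)
    thus ?thesis using True
      by (simp add: carleson_powr_coeff_def carleson_symbol_def coeff_linear_poly_power binomial_gbinomial)
  next
    case False
    have "degree (carleson_symbol (z i) ^ k) \<le> 1 * k"
      by (rule order_trans[OF degree_power_le mult_right_mono]) (auto simp: carleson_symbol_def)
    hence "coeff (carleson_symbol (z i) ^ k) j = 0" using False by (intro coeff_eq_0) simp
    moreover have "(of_nat k gchoose j :: complex) = 0"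
      using False by (simp add: binomial_gbinomial[symmetric] binomial_eq_0)
    ultimately show ?thesis by (simp add: carleson_powr_coeff_def)
  qed
  hence "(\<lambda>i. carleson_powr_coeff (of_nat k) (z i)) = (\<lambda>i. coeff (carleson_symbol (z i) ^ k))"
    by (simp add: fun_eq_iff)
  thus ?thesis by (simp only: carleson_op_powr_toeplitz[OF assms(1)] carleson_op_funpow[OF assms(1)])
qed

lemma block_toeplitz_poly:
  assumes pos: "\<And>i. 0 < n i"
  shows "block_toeplitz n (\<lambda>i. coeff ((p \<circ>\<^sub>p carleson_symbol (z i) ^ d) * carleson_symbol (z i) ^ l)) h m
       = (\<Sum>k\<le>degree p. coeff p k * (carleson_op n z ^^ (d * k + l)) h m)"
proof -
  have "(p \<circ>\<^sub>p q ^ d) * q ^ l = (\<Sum>k\<le>degree p. [:coeff p k:] * q ^ (d * k + l))" for q :: "complex poly"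
    by (simp add: pcompose_altdef poly_altdef degree_map_poly coeff_map_poly sum_distrib_right
        power_add power_mult)
  thus ?thesis unfolding carleson_op_funpow[OF pos] block_toeplitz_def
    by (simp add: coeff_sum sum_distrib_left sum_distrib_right mult.assoc)
      (rule sum.swap)
qed

lemma sums_shift_square:
  assumes "v \<in> ell2"
  shows "(\<lambda>m. if j \<le> m then (cmod (v (m - j)))\<^sup>2 else 0) sums ell2_normsq v"
proof -
  have "(\<lambda>m. if j \<le> m + j then (cmod (v (m + j - j)))\<^sup>2 else 0) sums ell2_normsq v"
    using summable_sums[OF ell2_summable[OF assms]] by (simp add: ell2_normsq_def)
  thus ?thesis by (subst sums_zero_iff_shift[symmetric, of j]) auto
qed

lemma sum_offset_le:
  fixes f :: "nat \<Rightarrow> real"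
  assumes "\<And>i. 0 < n i" "\<And>i. n i \<le> N" "\<And>j. 0 \<le> f j"
  shows "(\<Sum>j\<le>block_offset n m. f j) \<le> (\<Sum>j<N. if j \<le> m then f j else 0)"
proof -
  have lt: "block_offset n m < N"
    using block_decomposition(1)[of n m, OF assms(1)] assms(2) order_less_le_trans by blast
  have "(\<Sum>j\<le>block_offset n m. f j) = (\<Sum>j\<le>block_offset n m. if j \<le> m then f j else 0)"
    using block_shift(3)[of n _ m, OF assms(1)] by (intro sum.cong) auto
  also have "\<dots> \<le> (\<Sum>j<N. if j \<le> m then f j else 0)"
    using lt assms(3) by (intro sum_mono2) auto
  finally show ?thesis .
qed

text \<open>Bounded block sizes turn entrywise bounds into operator norm bounds: each output coordinate
  involves at most \<open>N\<close> shifted input coordinates.\<close>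

lemma block_toeplitz_bounded:
  assumes pos: "\<And>i. 0 < n i" and N: "\<And>i. n i \<le> N"
    and c: "\<And>i j. j < n i \<Longrightarrow> cmod (c i j) \<le> K" and K: "0 \<le> K" and v: "v \<in> ell2"
  shows "block_toeplitz n c v \<in> ell2"
    and "ell2_normsq (block_toeplitz n c v) \<le> (K * N)\<^sup>2 * ell2_normsq v"
proof -
  define b where "b m = K\<^sup>2 * N * (\<Sum>j<N. if j \<le> m then (cmod (v (m - j)))\<^sup>2 else 0)" for m
  have b: "b sums (K\<^sup>2 * N * (\<Sum>j<N. ell2_normsq v))"
    unfolding b_def by (intro sums_mult sums_sum sums_shift_square v)
  have le: "(cmod (block_toeplitz n c v m))\<^sup>2 \<le> b m" for m
  proof -
    let ?r = "block_offset n m"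
    have r: "?r < n (block_index n m)" by (rule block_decomposition(1)[of n, OF pos])
    have "cmod (block_toeplitz n c v m) \<le> (\<Sum>j\<le>?r. K * cmod (v (m - j)))"
      unfolding block_toeplitz_def using r
      by (intro sum_norm_le) (auto simp: norm_mult intro!: mult_right_mono c)
    hence "(cmod (block_toeplitz n c v m))\<^sup>2 \<le> (\<Sum>j\<le>?r. K * cmod (v (m - j)))\<^sup>2"
      by (intro power_mono) auto
    also have "\<dots> \<le> (\<Sum>j\<le>?r. (K * cmod (v (m - j)))\<^sup>2) * card {..?r}"
      by (rule sum_squared_le_sum_of_squares)
    also have "\<dots> \<le> (\<Sum>j\<le>?r. (K * cmod (v (m - j)))\<^sup>2) * real N"
      using r N[of "block_index n m"] by (intro mult_left_mono sum_nonneg) auto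
    also have "\<dots> = K\<^sup>2 * N * (\<Sum>j\<le>?r. (cmod (v (m - j)))\<^sup>2)"
      by (simp add: power_mult_distrib sum_distrib_left sum_distrib_right mult_ac)
    also have "\<dots> \<le> b m" unfolding b_def
      by (intro mult_left_mono sum_offset_le pos N) auto
    finally show ?thesis .
  qed
  show mem: "block_toeplitz n c v \<in> ell2" unfolding ell2_def mem_Collect_eq
    using summable_comparison_test'[OF sums_summable[OF b], of 0 "\<lambda>m. (cmod (block_toeplitz n c v m))\<^sup>2"] le
    by simp
  have "ell2_normsq (block_toeplitz n c v) \<le> suminf b"
    unfolding ell2_normsq_def by (intro suminf_le le ell2_summable mem sums_summable[OF b])
  also have "\<dots> = (K * N)\<^sup>2 * ell2_normsq v"
    using sums_unique[OF b] by (simp add: power2_eq_square mult_ac)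
  finally show "ell2_normsq (block_toeplitz n c v) \<le> (K * N)\<^sup>2 * ell2_normsq v" .
qed

section \<open>Consequences of the frame inequalities\<close>

lemma sums_block_delta: "(\<lambda>m. block_delta n i j m * f m) sums f (block_start n i + j)"
proof -
  have "(\<lambda>m. block_delta n i j m * f m) = (\<lambda>m. if m = block_start n i + j then f m else 0)"
    by (auto simp: block_delta_def)
  thus ?thesis using sums_single[of "block_start n i + j" f] by simp
qed

lemma ell2_block_delta: "block_delta n i j \<in> ell2" "ell2_normsq (block_delta n i j) = 1"
proof -
  have "(\<lambda>m. (cmod (block_delta n i j m))\<^sup>2)
      = (\<lambda>m. if m = block_start n i + j then 1 else 0)" by (auto simp: block_delta_def)
  hence "(\<lambda>m. (cmod (block_delta n i j m))\<^sup>2) sums 1"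
    using sums_single[of "block_start n i + j" "\<lambda>_. 1 :: real"] by simp
  thus "block_delta n i j \<in> ell2" "ell2_normsq (block_delta n i j) = 1"
    by (auto simp: ell2_def ell2_normsq_def sums_iff)
qed

lemma eigenvalue_in_point_spectrum:
  assumes "\<And>i. 0 < n i" shows "z i \<in> point_spectrum (carleson_op n z)"
  unfolding point_spectrum_def mem_Collect_eq
proof (intro bexI conjI)
  let ?d = "block_delta n i (n i - 1)"
  show "?d \<in> ell2" by (rule ell2_block_delta)
  have "?d (block_start n i + (n i - 1)) = 1" by (simp add: block_delta_def)
  thus "?d \<noteq> (\<lambda>m. 0)" by (metis zero_neq_one)
  show "carleson_op n z ?d = (\<lambda>m. z i * ?d m)"
    using carleson_op_block_delta[of n "n i - 1" i z, OF assms] assms[of i] by simp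
qed

lemma frame_orthogonal_trivial:
  assumes "is_frame f" "h \<in> ell2" "\<And>k. ell2_inner h (f k) = 0"
  shows "h = (\<lambda>m. 0)"
proof -
  obtain A where "A > 0" "A * (ell2_norm h)\<^sup>2 \<le> (\<Sum>k. (cmod (ell2_inner h (f k)))\<^sup>2)"
    using assms(1,2) unfolding is_frame_def by blast
  hence "A * ell2_normsq h \<le> 0"
    using assms(3) ell2_normsq_nonneg[OF assms(2)] by (simp add: ell2_norm_eq)
  hence "ell2_normsq h \<le> 0" using \<open>A > 0\<close> by (simp add: mult_le_0_iff)
  thus ?thesis using ell2_normsq_nonneg[OF assms(2)] ell2_normsq_eq_0_iff[OF assms(2)] by simp
qed

text \<open>Testing the lower frame bound on the first basis vector of block \<open>i\<close>, an eigenvector of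
  the adjoint, bounds \<open>1 - (x i)\<^sup>2\<close> by a constant times the squared modulus of the first
  coordinate of \<open>g\<close> in that block; these squares are summable.\<close>

lemma frame_imp_summable_gap:
  assumes pos: "\<And>i. 0 < n i" and z: "\<And>i. z i = complex_of_real (x i)"
    and x: "\<And>i. 0 < x i" "\<And>i. x i < 1"
    and g: "g \<in> ell2" and frame: "is_frame (\<lambda>k. (carleson_op n z ^^ k) g)"
  shows "summable (\<lambda>i. 1 - x i)"
proof -
  obtain A where A: "A > 0" "\<And>h. h \<in> ell2 \<Longrightarrow>
      A * (ell2_norm h)\<^sup>2 \<le> (\<Sum>k. (cmod (ell2_inner h ((carleson_op n z ^^ k) g)))\<^sup>2)"
    using frame unfolding is_frame_def by blast
  have bound: "1 - x i \<le> (cmod (g (block_start n i)))\<^sup>2 / A" for i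
  proof -
    let ?s = "block_start n i"
    have sq: "0 \<le> (x i)\<^sup>2" "(x i)\<^sup>2 < 1" "(x i)\<^sup>2 \<le> x i"
      using x[of i] power_less_one_iff[of "x i" 2] by (simp_all add: power2_eq_square)
    have "(carleson_op n z ^^ k) g ?s = z i ^ k * g ?s" for k
    proof -
      have "block_index n ?s = i" using block_index_eq[of n 0 i, OF pos pos] by simp
      moreover from this have "block_offset n ?s = 0" by (simp add: block_offset_def)
      ultimately show ?thesis
        by (simp add: carleson_op_funpow[OF pos] block_toeplitz_def coeff_0_power carleson_symbol_def)
    qed
    hence inner: "ell2_inner (block_delta n i 0) ((carleson_op n z ^^ k) g) = cnj (z i ^ k * g ?s)" for k
      unfolding ell2_inner_def
      using sums_unique[OF sums_block_delta[of n i 0 "\<lambda>m. cnj ((carleson_op n z ^^ k) g m)"]] by simp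
    have "(cmod (ell2_inner (block_delta n i 0) ((carleson_op n z ^^ k) g)))\<^sup>2
        = ((x i)\<^sup>2) ^ k * (cmod (g ?s))\<^sup>2" for k
      unfolding inner using x[of i]
      by (simp add: z norm_mult norm_power power_mult_distrib power_mult[symmetric] mult.commute)
    hence "A \<le> (\<Sum>k. ((x i)\<^sup>2) ^ k * (cmod (g ?s))\<^sup>2)"
      using A(2)[OF ell2_block_delta(1)[of n i 0]] by (simp add: ell2_norm_eq ell2_block_delta)
    also have "\<dots> = 1 / (1 - (x i)\<^sup>2) * (cmod (g ?s))\<^sup>2"
      using sums_unique[OF sums_mult2[OF geometric_sums[of "(x i)\<^sup>2"], of "(cmod (g ?s))\<^sup>2"]] sq by simp
    finally have "A * (1 - (x i)\<^sup>2) \<le> (cmod (g ?s))\<^sup>2" using sq by (simp add: field_simps)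
    hence "1 - (x i)\<^sup>2 \<le> (cmod (g ?s))\<^sup>2 / A" using A(1) by (simp add: field_simps)
    thus ?thesis using sq by linarith
  qed
  have "summable ((\<lambda>m. (cmod (g m))\<^sup>2) \<circ> block_start n)"
    using strict_mono_block_start[of n, OF pos]
    by (intro summable_reindex ell2_summable g strict_mono_imp_inj_on) auto
  hence "summable (\<lambda>i. (cmod (g (block_start n i)))\<^sup>2 / A)"
    by (intro summable_divide) (simp add: o_def)
  thus ?thesis
    using summable_comparison_test'[of "\<lambda>i. (cmod (g (block_start n i)))\<^sup>2 / A" 0 "\<lambda>i. 1 - x i"]
      bound x by (simp add: less_imp_le)
qed

text \<open>Summable gaps force \<open>x i\<close> to tend to \<open>1\<close>, so only finitely many of the positive numbers
  \<open>x i\<close> lie below \<open>1/2\<close>. The bound \<open>\<delta>\<close> controls the negative powers of \<open>x i\<close> that occur in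
  \<open>J ^ w\<close> when the real part of the exponent is smaller than the block size.\<close>

lemma summable_gap_imp_bounded_below:
  assumes "summable (\<lambda>i. 1 - x i)" "\<And>i. 0 < (x i :: real)"
  obtains \<delta> where "0 < \<delta>" "\<delta> < 1" "\<And>i. \<delta> \<le> x i"
proof -
  have "(\<lambda>i. 1 - x i) \<longlonglongrightarrow> 0" by (rule summable_LIMSEQ_zero[OF assms(1)])
  hence "\<forall>\<^sub>F i in sequentially. 1 - x i < 1/2" by (rule order_tendstoD) simp
  then obtain I where I: "\<And>i. i \<ge> I \<Longrightarrow> 1 - x i < 1/2" by (auto simp: eventually_sequentially)
  define \<delta> where "\<delta> = Min (insert (1/2) (x ` {..<I}))"
  have "0 < \<delta>" using assms(2) by (auto simp: \<delta>_def)
  moreover have "\<delta> \<le> 1/2" unfolding \<delta>_def by (rule Min_le) auto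
  moreover have "\<delta> \<le> x i" for i
  proof (cases "i < I")
    case True thus ?thesis by (auto simp: \<delta>_def intro: Min_le)
  next
    case False thus ?thesis using I[of i] \<open>\<delta> \<le> 1/2\<close> by linarith
  qed
  ultimately show thesis using that[of \<delta>] by auto
qed

section \<open>Sufficiency of the Muentz condition\<close>

text \<open>The map \<open>w \<mapsto> 2 w / (1 - w)\<close> takes the unit disc onto the half plane \<open>Re s > -1\<close>. This half
  plane is chosen, rather than \<open>Re s > 0\<close>, so that the exponent \<open>0\<close> corresponds to an interior
  point (namely \<open>0\<close>), and a zero at the exponent \<open>0\<close> needs no separate treatment.\<close>

lemma cayley_half_plane:
  assumes "cmod w < 1" shows "-1 < Re (2 * w / (1 - w))" "1 - w \<noteq> 0"
proof -
  show ne: "1 - w \<noteq> 0" using assms by auto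
  have "0 < (1 - (cmod w)\<^sup>2) / (cmod (1 - w))\<^sup>2"
    using assms ne by (intro divide_pos_pos) (auto simp: power_less_one_iff)
  also have "\<dots> = Re (2 * w / (1 - w)) + 1"
  proof -
    have "2 * w / (1 - w) + 1 = (1 + w) / (1 - w)" using ne by (simp add: field_simps)
    also have "\<dots> = (1 + w) * cnj (1 - w) / of_real ((cmod (1 - w))\<^sup>2)"
      by (rule complex_div_cnj)
    finally have "Re (2 * w / (1 - w) + 1) = Re ((1 + w) * cnj (1 - w)) / (cmod (1 - w))\<^sup>2"
      by (simp only: Re_divide_of_real)
    moreover have "Re ((1 + w) * cnj (1 - w)) = 1 - (cmod w)\<^sup>2"
      by (simp only: cmod_power2) (simp add: power2_eq_square algebra_simps)
    ultimately show ?thesis by simp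
  qed
  finally show "-1 < Re (2 * w / (1 - w))" by simp
qed

text \<open>The binomial coefficient is a polynomial of degree \<open>j\<close> in the exponent, so its pole at
  \<open>w = 1\<close> is cancelled by \<open>(1 - w) ^ j\<close>.\<close>

lemma cayley_gbinomial_bound:
  assumes "cmod w < 1"
  shows "cmod ((1 - w) ^ j * ((2 * w / (1 - w)) gchoose j)) \<le> 4 ^ j"
proof -
  have ne: "1 - w \<noteq> 0" by (rule cayley_half_plane(2)[OF assms])
  have "(1 - w) ^ j * ((2 * w / (1 - w)) gchoose j)
      = (\<Prod>i = 0..<j. (1 - w) * (2 * w / (1 - w) - of_nat i) / of_nat (Suc i))"
  proof -
    have "fact j = (\<Prod>i = 0..<j. of_nat (Suc i) :: complex)"
      by (simp add: fact_prod_Suc)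
    moreover have "(1 - w) ^ j = (\<Prod>i = 0..<j. 1 - w)" by simp
    ultimately show ?thesis unfolding gbinomial_prod_rev by (simp only: prod.distrib prod_dividef times_divide_eq_right)
  qed
  also have "cmod \<dots> \<le> (\<Prod>i = 0..<j. 4)"
    unfolding prod_norm[symmetric]
  proof (intro prod_mono conjI norm_ge_zero)
    fix i :: nat
    have "(1 - w) * (2 * w / (1 - w) - of_nat i) = 2 * w - (1 - w) * of_nat i"
      using ne by (simp add: right_diff_distrib)
    also have "cmod \<dots> \<le> 2 + 2 * real i"
    proof -
      have "cmod (1 - w) \<le> 2" using norm_triangle_ineq4[of 1 w] assms by simp
      hence "cmod ((1 - w) * of_nat i) \<le> 2 * real i" by (simp add: norm_mult mult_right_mono)
      moreover have "cmod (2 * w) \<le> 2" using assms by (simp add: norm_mult)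
      ultimately show ?thesis using norm_triangle_ineq4[of "2 * w" "(1 - w) * of_nat i"] by linarith
    qed
    also have "\<dots> \<le> 4 * real (Suc i)" by simp
    finally show "cmod ((1 - w) * (2 * w / (1 - w) - of_nat i) / of_nat (Suc i)) \<le> 4"
      by (simp add: norm_divide divide_le_eq del: of_nat_Suc)
  qed
  finally show ?thesis by simp
qed

text \<open>Together the powers of \<open>1 - w\<close> and the lower bound on the eigenvalues make the entries of \<open>J ^ s\<close>
  bounded over the whole half plane, uniformly in the block; without the factor \<open>(1 - w) ^ N\<close> they grow
  polynomially in \<open>s\<close> on blocks of size at least two.\<close>

lemma cayley_powr_coeff_bound:
  assumes w: "cmod w < 1" and x: "0 < \<delta>" "\<delta> \<le> x" "x < 1" and j: "j < N"
  shows "cmod ((1 - w) ^ N * carleson_powr_coeff (2 * w / (1 - w)) (complex_of_real x) j)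
       \<le> 2 ^ N * 4 ^ N * exp ((1 + real N) * - ln \<delta>)"
proof -
  define s where "s = 2 * w / (1 - w)"
  have re: "-1 < Re s" using cayley_half_plane(1)[OF w] by (simp add: s_def)
  have "(1 - w) ^ N = (1 - w) ^ (N - j) * (1 - w) ^ j"
    using j by (simp add: power_add[symmetric])
  hence "(1 - w) ^ N * carleson_powr_coeff s (of_real x) j
      = (1 - w) ^ (N - j) * ((1 - w) ^ j * (s gchoose j)) * of_real x powr (s - of_nat j)
        * (1 - (of_real (cmod (of_real x)))\<^sup>2) ^ j"
    by (simp add: carleson_powr_coeff_def mult_ac)
  also have "cmod \<dots> \<le> 2 ^ N * 4 ^ N * exp ((1 + real N) * - ln \<delta>) * 1"
    unfolding norm_mult[of _ "_ ^ j"] norm_mult[of _ "_ powr _"] norm_mult[of "_ ^ (N - j)"]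
  proof (intro mult_mono mult_nonneg_nonneg norm_ge_zero)
    have "cmod (1 - w) \<le> 2" using norm_triangle_ineq4[of 1 w] w by simp
    hence "cmod ((1 - w) ^ (N - j)) \<le> 2 ^ (N - j)" by (simp add: norm_power power_mono)
    also have "\<dots> \<le> 2 ^ N" by (rule power_increasing) auto
    finally show "cmod ((1 - w) ^ (N - j)) \<le> 2 ^ N" .
    have "(4::real) ^ j \<le> 4 ^ N" using j by (intro power_increasing) auto
    thus "cmod ((1 - w) ^ j * (s gchoose j)) \<le> 4 ^ N"
      using order_trans[OF cayley_gbinomial_bound[OF w, of j]] by (simp add: s_def)
    have "cmod (of_real x powr (s - of_nat j)) = exp ((Re s - real j) * ln x)"
      using x by (subst norm_powr_real) auto
    also have "\<dots> \<le> exp ((1 + real N) * - ln \<delta>)"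
    proof -
      have "(Re s - real j) * ln x \<le> (- (1 + real N)) * ln x"
        using x re j by (intro mult_right_mono_neg) auto
      also have "\<dots> = (1 + real N) * - ln x" by (simp add: algebra_simps)
      also have "\<dots> \<le> (1 + real N) * - ln \<delta>" using x by (intro mult_left_mono) auto
      finally show ?thesis by simp
    qed
    finally show "cmod (of_real x powr (s - of_nat j)) \<le> exp ((1 + real N) * - ln \<delta>)" .
    have "1 - (complex_of_real (cmod (of_real x)))\<^sup>2 = of_real (1 - x\<^sup>2)"
      using x by (simp add: abs_of_pos)
    hence "cmod (1 - (complex_of_real (cmod (of_real x)))\<^sup>2) \<le> 1"
      using x by (simp only: norm_of_real) (simp add: power_le_one abs_le_iff)
    thus "cmod ((1 - (complex_of_real (cmod (of_real x)))\<^sup>2) ^ j) \<le> 1"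
      by (simp add: norm_power power_le_one)
  qed auto
  finally show ?thesis by (simp add: s_def)
qed

lemma carleson_op_powr_cayley_ell2:
  assumes pos: "\<And>i. 0 < n i" and N: "\<And>i. n i \<le> N"
    and z: "\<And>i. z i = complex_of_real (x i)" and x: "0 < \<delta>" "\<And>i. \<delta> \<le> x i" "\<And>i. x i < 1"
    and g: "g \<in> ell2" and w: "cmod w < 1"
  shows "carleson_op_powr n z (2 * w / (1 - w)) g \<in> ell2"
proof -
  define K where "K = 2 ^ N * 4 ^ N * exp ((1 + real N) * - ln \<delta>) / cmod ((1 - w) ^ N)"
  have ne: "(1 - w) ^ N \<noteq> 0" using cayley_half_plane(2)[OF w] by simp
  have "cmod (carleson_powr_coeff (2 * w / (1 - w)) (z i) j) \<le> K" if "j < n i" for i j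
  proof -
    have "j < N" using that N[of i] by simp
    from cayley_powr_coeff_bound[OF w x(1) x(2) x(3) this, of i] show ?thesis
      unfolding K_def using ne by (intro mult_imp_le_div_pos) (simp_all add: z norm_mult mult_ac)
  qed
  moreover have "0 \<le> K" by (simp add: K_def)
  ultimately show ?thesis unfolding carleson_op_powr_toeplitz[OF pos]
    by (intro block_toeplitz_bounded(1)[of n N _ K] pos N g)
qed

lemma cayley_of_real:
  fixes t :: real
  assumes "0 \<le> t"
  defines "w \<equiv> complex_of_real (t / (t + 2))"
  shows "cmod w < 1" "2 * w / (1 - w) = of_real t" "1 - cmod w = 2 / (t + 2)"
proof -
  have nw: "cmod w = t / (t + 2)" using assms(1) unfolding w_def norm_of_real by simp
  show "cmod w < 1" "1 - cmod w = 2 / (t + 2)"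
    using assms(1) by (simp_all add: nw field_simps)
  have "2 * (t / (t + 2)) / (1 - t / (t + 2)) = t" using assms(1) by (simp add: divide_simps)
  hence "of_real (2 * (t / (t + 2)) / (1 - t / (t + 2))) = complex_of_real t" by (simp only:)
  thus "2 * w / (1 - w) = of_real t" by (simp add: w_def)
qed

corollary carleson_op_powr_ell2:
  assumes "\<And>i. 0 < n i" "\<And>i. n i \<le> N"
    and "\<And>i. z i = complex_of_real (x i)" "0 < \<delta>" "\<And>i. \<delta> \<le> x i" "\<And>i. x i < 1"
    and "g \<in> ell2" and "0 \<le> t"
  shows "carleson_op_powr n z (complex_of_real t) g \<in> ell2"
  using carleson_op_powr_cayley_ell2[OF assms(1-7) cayley_of_real(1)[OF assms(8)]]
  by (simp only: cayley_of_real(2)[OF assms(8)])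

text \<open>As a function of \<open>w\<close> in the disc, \<open>(1 - w) ^ N \<langle>J ^ s g, h\<rangle>\<close> with \<open>s = 2 w / (1 - w)\<close> is bounded and
  holomorphic. It vanishes at the points \<open>\<lambda> / (\<lambda> + 2)\<close>, whose distance \<open>2 / (\<lambda> + 2)\<close> to the unit
  circle is at least \<open>\<lambda> / (\<lambda>\<^sup>2 + 1)\<close>. The Muentz condition is therefore enough for Blaschke's theorem,
  and the function vanishes identically.\<close>

theorem muntz_orthogonal:
  assumes pos: "\<And>i. 0 < n i" and N: "\<And>i. n i \<le> N"
    and z: "\<And>i. z i = complex_of_real (x i)" and x: "0 < \<delta>" "\<And>i. \<delta> \<le> x i" "\<And>i. x i < 1"
    and g: "g \<in> ell2" and h: "h \<in> ell2"
    and lam: "inj lam" "\<And>k. 0 \<le> lam k" "\<not> summable (\<lambda>k. lam k / ((lam k)\<^sup>2 + 1))"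
    and orth: "\<And>k. ell2_inner h (carleson_op_powr n z (complex_of_real (lam k)) g) = 0"
    and t: "0 \<le> t"
  shows "ell2_inner h (carleson_op_powr n z (complex_of_real t) g) = 0"
proof -
  define K where "K = 2 ^ N * 4 ^ N * exp ((1 + real N) * - ln \<delta>)"
  define s where "s w = 2 * w / (1 - w)" for w :: complex
  define F where "F m w = (1 - w) ^ N * (cnj (h m) * carleson_op_powr n z (s w) g m)" for m w
  define G where "G w = (\<Sum>m. F m w)" for w
  define B where "B = block_toeplitz n (\<lambda>_ _. complex_of_real K) (\<lambda>m. complex_of_real (cmod (g m)))"
  have K: "0 \<le> K" by (simp add: K_def)
  have B: "B \<in> ell2" unfolding B_def
    by (rule block_toeplitz_bounded(1)[of n N _ K, OF pos N]) (use g K in \<open>auto simp: ell2_def\<close>)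
  have summ: "summable (\<lambda>m. cmod (h m) * cmod (B m))" by (rule summable_ell2_inner(2)[OF h B])
  have F_le: "cmod (F m w) \<le> cmod (h m) * cmod (B m)" if w: "cmod w < 1" for m w
  proof -
    let ?i = "block_index n m"
    have "F m w = cnj (h m) *
        (\<Sum>j\<le>block_offset n m. ((1 - w) ^ N * carleson_powr_coeff (s w) (z ?i) j) * g (m - j))"
      by (simp add: F_def carleson_op_powr_toeplitz[OF pos] block_toeplitz_def sum_distrib_left mult_ac)
    also have "cmod \<dots> \<le> cmod (h m) * (\<Sum>j\<le>block_offset n m. K * cmod (g (m - j)))"
      unfolding norm_mult[of "cnj (h m)"] complex_mod_cnj
    proof (intro mult_left_mono sum_norm_le norm_ge_zero)
      fix j assume "j \<in> {..block_offset n m}"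
      hence "j < N" using block_decomposition(1)[of n m, OF pos] N[of ?i] by auto
      from cayley_powr_coeff_bound[OF w x(1) x(2) x(3) this, of ?i]
      show "cmod ((1 - w) ^ N * carleson_powr_coeff (s w) (z ?i) j * g (m - j)) \<le> K * cmod (g (m - j))"
        unfolding norm_mult[of _ "g (m - j)"]
        by (intro mult_right_mono norm_ge_zero) (simp add: z s_def K_def)
    qed
    also have "(\<Sum>j\<le>block_offset n m. K * cmod (g (m - j))) = cmod (B m)"
    proof -
      have "B m = complex_of_real (\<Sum>j\<le>block_offset n m. K * cmod (g (m - j)))"
        by (simp add: B_def block_toeplitz_def)
      thus ?thesis using K by (simp only: norm_of_real) (simp add: sum_nonneg)
    qed
    finally show ?thesis .
  qed
  have unif: "uniform_limit (ball 0 1) (\<lambda>M w. \<Sum>m<M. F m w) G sequentially"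
    unfolding G_def by (rule Weierstrass_m_test[OF _ summ]) (use F_le in auto)
  have F_hol: "F m holomorphic_on ball 0 1" for m
  proof -
    have zne: "z i \<noteq> 0" for i using x(1) x(2)[of i] by (auto simp: z)
    have s: "s holomorphic_on ball 0 1"
      unfolding s_def by (intro holomorphic_intros) auto
    have "(\<lambda>w. carleson_powr_coeff (s w) (z i) j) holomorphic_on ball 0 1" for i j
      unfolding carleson_powr_coeff_def gbinomial_prod_rev
      by (intro holomorphic_intros s) (use zne in auto)
    thus ?thesis unfolding F_def carleson_op_powr_toeplitz[OF pos] block_toeplitz_def
      by (intro holomorphic_intros)
  qed
  have G_hol: "G holomorphic_on ball 0 1"
  proof (rule holomorphic_uniform_sequence)
    show "(\<lambda>w. \<Sum>m<M. F m w) holomorphic_on ball 0 1" for M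
      by (intro holomorphic_on_sum F_hol)
    fix w :: complex assume "w \<in> ball 0 1"
    then obtain d where "0 < d" "cball w d \<subseteq> ball 0 1"
      using open_contains_cball[of "ball 0 1 :: complex set"] open_ball by blast
    thus "\<exists>d>0. cball w d \<subseteq> ball 0 1 \<and> uniform_limit (cball w d) (\<lambda>M w. \<Sum>m<M. F m w) G sequentially"
      using uniform_limit_on_subset[OF unif] by blast
  qed simp
  have G_le: "cmod (G w) \<le> (\<Sum>m. cmod (h m) * cmod (B m))" if "cmod w < 1" for w
    unfolding G_def by (rule norm_suminf_le[OF F_le[OF that] summ])
  have powr_ell2: "carleson_op_powr n z (s w) g \<in> ell2" if "cmod w < 1" for w
    unfolding s_def by (rule carleson_op_powr_cayley_ell2[OF pos N z x g that])
  have G_eq: "G w = (1 - w) ^ N * cnj (ell2_inner h (carleson_op_powr n z (s w) g))" if w: "cmod w < 1" for w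
  proof -
    have "(\<lambda>m. h m * cnj (carleson_op_powr n z (s w) g m)) sums ell2_inner h (carleson_op_powr n z (s w) g)"
      unfolding ell2_inner_def by (intro summable_sums summable_ell2_inner h powr_ell2 w)
    hence "(\<lambda>m. cnj (h m * cnj (carleson_op_powr n z (s w) g m)))
        sums cnj (ell2_inner h (carleson_op_powr n z (s w) g))" by (simp only: sums_cnj)
    from sums_mult[OF this, of "(1 - w) ^ N"] show ?thesis
      by (simp add: G_def F_def sums_iff)
  qed
  define \<alpha> where "\<alpha> t = complex_of_real (t / (t + 2))" for t
  have \<alpha>: "cmod (\<alpha> t) < 1" "s (\<alpha> t) = of_real t" "1 - cmod (\<alpha> t) = 2 / (t + 2)" if "0 \<le> t" for t
    using cayley_of_real[OF that] by (simp_all only: s_def \<alpha>_def)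
  have zeros: "G (\<alpha> (lam k)) = 0" for k
    using G_eq[OF \<alpha>(1)[OF lam(2)]] orth[of k] by (simp add: \<alpha>(2)[OF lam(2)])
  have inj: "inj (\<lambda>k. \<alpha> (lam k))"
    using lam(1) \<alpha>(2)[OF lam(2)] by (metis injI inj_eq of_real_eq_iff)
  have div: "\<not> summable (\<lambda>k. 1 - cmod (\<alpha> (lam k)))"
  proof
    assume gap: "summable (\<lambda>k. 1 - cmod (\<alpha> (lam k)))"
    have "norm (lam k / ((lam k)\<^sup>2 + 1)) \<le> 1 - cmod (\<alpha> (lam k))" for k
    proof -
      let ?l = "lam k"
      \<comment> \<open>The inequality \<open>\<lambda> / (\<lambda>\<^sup>2 + 1) \<le> 2 / (\<lambda> + 2)\<close> is \<open>0 \<le> (\<lambda> - 1)\<^sup>2 + 1\<close> after clearing denominators.\<close>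
      have "0 \<le> (?l - 1)\<^sup>2" by simp
      hence "?l * (?l + 2) \<le> 2 * (?l\<^sup>2 + 1)" by (simp add: power2_eq_square algebra_simps)
      moreover have "0 < ?l\<^sup>2 + 1" by (rule add_nonneg_pos) auto
      ultimately have "?l / (?l\<^sup>2 + 1) \<le> 2 / (?l + 2)"
        using lam(2)[of k] by (simp add: divide_le_eq pos_le_divide_eq mult.commute)
      thus ?thesis using lam(2)[of k] by (simp add: \<alpha>(3))
    qed
    hence "summable (\<lambda>k. lam k / ((lam k)\<^sup>2 + 1))"
      by (intro summable_comparison_test'[OF gap])
    thus False using lam(3) by contradiction
  qed
  have "G (\<alpha> t) = 0"
    by (rule blaschke_uniqueness[OF G_hol G_le _ zeros inj div]) (auto intro: \<alpha> lam t)
  thus ?thesis using G_eq[OF \<alpha>(1)[OF t]] cayley_half_plane(2)[OF \<alpha>(1)[OF t]] by (simp add: \<alpha>(2)[OF t])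
qed

section \<open>Polynomials annihilating the spectrum up to a small error\<close>

text \<open>The sum of the moduli of the coefficients is a submultiplicative norm that dominates every
  coefficient, which is all that is needed to bound Toeplitz entries of products.\<close>

definition poly_l1 :: "complex poly \<Rightarrow> real" where
  "poly_l1 p = sum_list (map cmod (coeffs p))"

lemma poly_l1_0 [simp]: "poly_l1 0 = 0"
  by (simp add: poly_l1_def)

lemma poly_l1_pCons [simp]: "poly_l1 (pCons a p) = cmod a + poly_l1 p"
  by (auto simp: poly_l1_def coeffs_pCons_eq_cCons cCons_def)

lemma poly_l1_nonneg: "0 \<le> poly_l1 p"
  by (induction p) auto

lemma poly_l1_1 [simp]: "poly_l1 1 = 1"
  by (simp add: one_pCons)

lemma poly_l1_add: "poly_l1 (p + q) \<le> poly_l1 p + poly_l1 q"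
  by (induction p q rule: poly_induct2) (auto intro: order_trans[OF add_mono[OF norm_triangle_ineq]])

lemma poly_l1_smult: "poly_l1 (Polynomial.smult a p) = cmod a * poly_l1 p"
  by (induction p) (auto simp: norm_mult algebra_simps)

lemma poly_l1_diff: "poly_l1 (p - q) \<le> poly_l1 p + poly_l1 q"
  using poly_l1_add[of p "- q"] poly_l1_smult[of "-1" q] by simp

lemma poly_l1_mult: "poly_l1 (p * q) \<le> poly_l1 p * poly_l1 q"
proof (induction p)
  case (pCons a p)
  have "poly_l1 (pCons a p * q) \<le> poly_l1 (Polynomial.smult a q) + poly_l1 (pCons 0 (p * q))"
    by (simp only: mult_pCons_left poly_l1_add)
  thus ?case using pCons by (simp add: poly_l1_smult algebra_simps)
qed simp

lemma poly_l1_power: "poly_l1 (p ^ k) \<le> poly_l1 p ^ k"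
proof (induction k)
  case (Suc k)
  thus ?case using poly_l1_mult[of p "p ^ k"] mult_left_mono[OF Suc poly_l1_nonneg[of p]] by simp
qed simp

lemma poly_l1_prod: "poly_l1 (\<Prod>i\<in>H. f i) \<le> (\<Prod>i\<in>H. poly_l1 (f i))"
proof (induction H rule: infinite_finite_induct)
  case (insert i H)
  thus ?case using poly_l1_mult[of "f i" "\<Prod>i\<in>H. f i"]
      mult_left_mono[OF insert.IH poly_l1_nonneg[of "f i"]] by simp
qed simp_all

lemma coeff_le_poly_l1: "cmod (coeff p k) \<le> poly_l1 p"
proof (induction p arbitrary: k)
  case (pCons a p)
  thus ?case using pCons.IH[of "k - 1"] poly_l1_nonneg[of p]
    by (cases k) (auto intro: add_increasing add_increasing2)
qed simp

lemma poly_l1_power_minus_1: "poly_l1 ((1 + y) ^ d - 1) \<le> (1 + poly_l1 y) ^ d - 1"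
proof (induction d)
  case (Suc d)
  let ?P = "(1 + y) ^ d - 1"
  have "(1 + y) ^ Suc d - 1 = ?P * (1 + y) + y" by (simp add: algebra_simps)
  hence "poly_l1 ((1 + y) ^ Suc d - 1) \<le> poly_l1 (?P * (1 + y)) + poly_l1 y"
    using poly_l1_add[of "?P * (1 + y)" y] by simp
  also have "poly_l1 (?P * (1 + y)) \<le> poly_l1 ?P * poly_l1 (1 + y)" by (rule poly_l1_mult)
  also have "\<dots> \<le> ((1 + poly_l1 y) ^ d - 1) * (1 + poly_l1 y)"
    using Suc poly_l1_add[of 1 y] poly_l1_nonneg[of y]
    by (intro mult_mono poly_l1_nonneg) (auto simp: poly_l1_nonneg)
  also have "\<dots> + poly_l1 y = (1 + poly_l1 y) ^ Suc d - 1" by (simp add: algebra_simps)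
  finally show ?case by simp
qed simp

text \<open>The coefficients of index below \<open>N\<close> are those a block of size at most \<open>N\<close> can see; this is
  the statement that a nilpotent matrix of size \<open>N\<close> has vanishing \<open>N\<close>-th power.\<close>

lemma coeff_mult_nilpotent_power:
  fixes P Q :: "complex poly"
  assumes "coeff P 0 = 0" "j < N" shows "coeff (Q * P ^ N) j = 0"
proof -
  obtain P' where "P = pCons 0 P'" using assms(1) by (cases P) auto
  hence "P = monom 1 1 * P'" by (simp add: monom_Suc)
  hence "P ^ N = monom 1 N * P' ^ N"
    by (simp only: power_mult_distrib monom_power) simp
  hence "Q * P ^ N = monom 1 N * (Q * P' ^ N)" by (simp only: mult.left_commute)
  thus ?thesis using assms(2) by (simp only: coeff_monom_mult) simp
qed

text \<open>The symbol is \<open>1 + y\<close> with \<open>y\<close> of norm at most \<open>3 (1 - x)\<close>: blocks whose eigenvalue is close to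
  \<open>1\<close> are small perturbations of the identity.\<close>

lemma real_symbol:
  assumes "0 < x" "x < 1"
  shows "carleson_symbol (complex_of_real x) = 1 + [:- complex_of_real (1 - x), complex_of_real (1 - x\<^sup>2):]"
    and "poly_l1 [:- complex_of_real (1 - x), complex_of_real (1 - x\<^sup>2):] \<le> 3 * (1 - x)"
    and "poly_l1 (carleson_symbol (complex_of_real x)) \<le> 2"
    and "coeff (carleson_symbol (complex_of_real x)) 0 = x"
proof -
  have x2: "0 \<le> 1 - x\<^sup>2" "1 - x\<^sup>2 \<le> 2 * (1 - x)"
  proof -
    have "0 \<le> (1 - x)\<^sup>2" by simp
    thus "1 - x\<^sup>2 \<le> 2 * (1 - x)" by (simp add: power2_eq_square algebra_simps)
    show "0 \<le> 1 - x\<^sup>2" using assms by (simp add: power_le_one)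
  qed
  show "carleson_symbol (complex_of_real x) = 1 + [:- complex_of_real (1 - x), complex_of_real (1 - x\<^sup>2):]"
    using assms by (simp add: carleson_symbol_def one_pCons abs_of_pos)
  have c: "cmod (complex_of_real (1 - x\<^sup>2)) = 1 - x\<^sup>2" "cmod (- complex_of_real (1 - x)) = 1 - x"
    using x2 assms unfolding norm_minus_cancel norm_of_real by auto
  show "poly_l1 [:- complex_of_real (1 - x), complex_of_real (1 - x\<^sup>2):] \<le> 3 * (1 - x)"
    using add_left_mono[OF x2(2), of "1 - x"] unfolding poly_l1_pCons poly_l1_0 c by simp
  have "carleson_symbol (complex_of_real x) = [:complex_of_real x, complex_of_real (1 - x\<^sup>2):]"
    using assms by (simp add: carleson_symbol_def abs_of_pos)
  hence "poly_l1 (carleson_symbol (complex_of_real x)) = x + (1 - x\<^sup>2)"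
    using assms by (simp only: poly_l1_pCons poly_l1_0 c) simp
  also have "\<dots> \<le> 2" using assms zero_le_power2[of x] by linarith
  finally show "poly_l1 (carleson_symbol (complex_of_real x)) \<le> 2" .
  show "coeff (carleson_symbol (complex_of_real x)) 0 = x" by (simp add: carleson_symbol_def)
qed

text \<open>In the variable \<open>Y = J ^ d\<close>: the product over \<open>H\<close> kills the blocks \<open>i \<in> H\<close>, where
  \<open>Y - (x i) ^ d\<close> is nilpotent, and the first factor makes the blocks near \<open>1\<close> small, where \<open>1 - Y\<close>
  is a contraction. The factors are normalised to have constant coefficient \<open>1\<close>.\<close>

definition annihilator :: "nat \<Rightarrow> nat \<Rightarrow> nat \<Rightarrow> nat set \<Rightarrow> (nat \<Rightarrow> real) \<Rightarrow> complex poly" where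
  "annihilator m N d H x = [:1, -1:] ^ m * (\<Prod>i\<in>H. [:1, - (1 / complex_of_real (x i) ^ d):] ^ N)"

lemma coeff_annihilator_0: "coeff (annihilator m N d H x) 0 = 1"
proof -
  have "poly (annihilator m N d H x) 0 = 1" by (simp add: annihilator_def poly_prod)
  thus ?thesis by (simp add: poly_0_coeff_0)
qed

lemma degree_annihilator: "degree (annihilator m N d H x) \<le> m + N * card H"
proof -
  have lin: "degree ([:1, c:] ^ k) \<le> k" for c :: complex and k
  proof -
    have "degree ([:1, c:] ^ k) \<le> degree [:1, c:] * k" by (rule degree_power_le)
    also have "\<dots> \<le> 1 * k" by (rule mult_right_mono) simp_all
    finally show ?thesis by simp
  qed
  have "degree (\<Prod>i\<in>H. [:1, - (1 / complex_of_real (x i) ^ d):] ^ N) \<le> N * card H"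
  proof (cases "finite H")
    case True
    have "degree (\<Prod>i\<in>H. [:1, - (1 / complex_of_real (x i) ^ d):] ^ N)
        \<le> (\<Sum>i\<in>H. degree ([:1, - (1 / complex_of_real (x i) ^ d):] ^ N))"
      using degree_prod_sum_le[OF True, of "\<lambda>i. [:1, - (1 / complex_of_real (x i) ^ d):] ^ N"]
      by (simp only: o_def)
    also have "\<dots> \<le> (\<Sum>i\<in>H. N)" by (rule sum_mono) (rule lin)
    finally show ?thesis by (simp add: mult.commute)
  qed simp
  hence "degree ([:1, -1:] ^ m :: complex poly) + degree (\<Prod>i\<in>H. [:1, - (1 / complex_of_real (x i) ^ d):] ^ N)
      \<le> m + N * card H"
    by (rule add_mono[OF lin])
  thus ?thesis unfolding annihilator_def by (rule order_trans[OF degree_mult_le])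
qed

lemma annihilator_pcompose:
  "annihilator m N d H x \<circ>\<^sub>p Y
   = (1 - Y) ^ m * (\<Prod>i\<in>H. (1 - Polynomial.smult (1 / complex_of_real (x i) ^ d) Y) ^ N)"
proof -
  have pow: "p ^ k \<circ>\<^sub>p Y = (p \<circ>\<^sub>p Y) ^ k" for p :: "complex poly" and k
    by (induction k) (simp_all add: pcompose_mult pcompose_1)
  have lin: "[:1, - c:] \<circ>\<^sub>p Y = 1 - Polynomial.smult c Y" for c
    by (simp add: pcompose_pCons one_pCons)
  show ?thesis unfolding annihilator_def
    by (simp only: pcompose_mult pcompose_prod pow lin smult_1_left)
qed

text \<open>On a block outside \<open>H\<close> the factor \<open>1 - J ^ d\<close> has norm at most \<open>1/2\<close>, while each of the
  \<open>N * card H\<close> remaining factors has norm at most \<open>(4 / \<delta>) ^ d \<le> 2 ^ (t * d)\<close>; the exponent \<open>m\<close>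
  is chosen to outweigh all of them and to leave \<open>(1/2) ^ d\<close> to spare.\<close>

lemma annihilator_small:
  assumes x: "0 < \<delta>" "\<And>i. \<delta> \<le> x i" "\<And>i. x i < 1" and \<delta>: "\<delta> < 1"
    and d: "0 < d" and t: "4 / \<delta> \<le> 2 ^ t"
    and far: "\<And>i. i \<notin> H \<Longrightarrow> 1 - x i \<le> 1 / (9 * real d)" and fin: "finite H"
    and m: "m = t * d * N * card H + d" and j: "j < N"
  defines "S \<equiv> (\<lambda>i. carleson_symbol (complex_of_real (x i)))"
  shows "cmod (coeff ((annihilator m N d H x \<circ>\<^sub>p S i ^ d) * S i ^ l) j) \<le> (1/2) ^ d * 2 ^ l"
proof (cases "i \<in> H")
  case True
  define P where "P k = 1 - Polynomial.smult (1 / complex_of_real (x k) ^ d) (S i ^ d)" for k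
  have "x i \<noteq> 0" using x(1) x(2)[of i] by linarith
  hence P0: "coeff (P i) 0 = 0"
    using real_symbol(4)[of "x i"] x(1) x(2)[of i] x(3)[of i]
    by (simp add: P_def S_def coeff_0_power)
  have "(annihilator m N d H x \<circ>\<^sub>p S i ^ d) * S i ^ l
      = ((1 - S i ^ d) ^ m * (\<Prod>k\<in>H - {i}. P k ^ N) * S i ^ l) * P i ^ N"
    unfolding annihilator_pcompose P_def[symmetric] prod.remove[OF fin True] by (simp only: mult_ac)
  thus ?thesis by (simp only: coeff_mult_nilpotent_power[OF P0 j]) simp
next
  case False
  have xi: "0 < x i" "x i < 1" for i using x(1) x(2)[of i] x(3)[of i] by auto
  have Si: "S i = carleson_symbol (complex_of_real (x i))" by (simp add: S_def)
  note sym = real_symbol[OF xi(1)[of i] xi(2)[of i], folded Si]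
  let ?y = "[:- complex_of_real (1 - x i), complex_of_real (1 - (x i)\<^sup>2):]"
  have near: "poly_l1 (1 - S i ^ d) \<le> 1 / 2"
  proof -
    have "poly_l1 (1 - S i ^ d) = poly_l1 (S i ^ d - 1)"
      using poly_l1_smult[of "-1" "S i ^ d - 1"] by simp
    also have "\<dots> \<le> (1 + poly_l1 ?y) ^ d - 1"
      unfolding sym(1) by (rule poly_l1_power_minus_1)
    also have "\<dots> \<le> (1 + 1 / (3 * real d)) ^ d - 1"
    proof -
      have "poly_l1 ?y \<le> 1 / (3 * real d)"
        using order_trans[OF sym(2) mult_left_mono[OF far[OF False], of 3]] by simp
      thus ?thesis using poly_l1_nonneg[of ?y] by (intro diff_right_mono power_mono) auto
    qed
    also have "\<dots> \<le> exp (1 / (3 * real d)) ^ d - 1"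
      using exp_ge_add_one_self by (intro diff_right_mono power_mono) auto
    also have "exp (1 / (3 * real d)) ^ d = exp (1 / 3 :: real)"
      using d by (simp add: exp_of_nat_mult[symmetric])
    also have "exp (1 / 3 :: real) - 1 \<le> 1 / 2"
      using exp_bound[of "1 / 3 :: real"] by (simp add: power2_eq_square)
    finally show ?thesis .
  qed
  have factor: "poly_l1 (1 - Polynomial.smult (1 / complex_of_real (x k) ^ d) (S i ^ d)) \<le> 2 ^ (t * d)" for k
  proof -
    have "poly_l1 (1 - Polynomial.smult (1 / complex_of_real (x k) ^ d) (S i ^ d))
        \<le> 1 + (1 / x k) ^ d * poly_l1 (S i ^ d)"
      using poly_l1_diff[of 1 "Polynomial.smult (1 / complex_of_real (x k) ^ d) (S i ^ d)"] xi[of k]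
      by (simp add: poly_l1_smult norm_divide norm_power power_divide abs_of_pos)
    also have "\<dots> \<le> 1 + (1 / \<delta>) ^ d * 2 ^ d"
    proof -
      have "poly_l1 (S i ^ d) \<le> 2 ^ d"
        using poly_l1_power[of "S i" d] power_mono[OF sym(3) poly_l1_nonneg, of d] by linarith
      moreover have "(1 / x k) ^ d \<le> (1 / \<delta>) ^ d"
        using x(1) x(2)[of k] by (intro power_mono divide_left_mono) auto
      ultimately show ?thesis using x(1) by (intro add_left_mono mult_mono poly_l1_nonneg) auto
    qed
    also have "\<dots> \<le> 2 * (2 / \<delta>) ^ d"
    proof -
      have "1 \<le> (2 / \<delta>) ^ d" using \<delta> x(1) by (intro one_le_power) simp
      thus ?thesis by (simp add: power_divide)
    qed
    also have "\<dots> \<le> 2 ^ d * (2 / \<delta>) ^ d"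
      using d x(1) self_le_power[of "2::real" d] by (intro mult_right_mono) auto
    also have "\<dots> = (4 / \<delta>) ^ d" by (simp add: power_mult_distrib[symmetric])
    also have "\<dots> \<le> (2 ^ t) ^ d" using t x(1) by (intro power_mono) auto
    finally show ?thesis by (simp add: power_mult)
  qed
  have "cmod (coeff ((annihilator m N d H x \<circ>\<^sub>p S i ^ d) * S i ^ l) j)
      \<le> poly_l1 ((annihilator m N d H x \<circ>\<^sub>p S i ^ d) * S i ^ l)"
    by (rule coeff_le_poly_l1)
  also have "\<dots> \<le> poly_l1 (annihilator m N d H x \<circ>\<^sub>p S i ^ d) * poly_l1 (S i ^ l)"
    by (rule poly_l1_mult)
  also have "\<dots> \<le> (1/2) ^ d * 2 ^ l"
  proof (intro mult_mono poly_l1_nonneg)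
    show "poly_l1 (S i ^ l) \<le> 2 ^ l"
      using poly_l1_power[of "S i" l] power_mono[OF sym(3) poly_l1_nonneg, of l] by linarith
    let ?F = "\<lambda>k. 1 - Polynomial.smult (1 / complex_of_real (x k) ^ d) (S i ^ d)"
    have "poly_l1 ((1 - S i ^ d) ^ m) \<le> (1/2) ^ m"
      using poly_l1_power[of "1 - S i ^ d" m] power_mono[OF near poly_l1_nonneg, of m] by linarith
    moreover have "poly_l1 (\<Prod>k\<in>H. ?F k ^ N) \<le> 2 ^ (t * d * N * card H)"
    proof -
      have "poly_l1 (\<Prod>k\<in>H. ?F k ^ N) \<le> (\<Prod>k\<in>H. poly_l1 (?F k ^ N))" by (rule poly_l1_prod)
      also have "\<dots> \<le> (\<Prod>k\<in>H. (2 ^ (t * d)) ^ N)"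
      proof (intro prod_mono conjI poly_l1_nonneg)
        fix k
        show "poly_l1 (?F k ^ N) \<le> (2 ^ (t * d)) ^ N"
          using poly_l1_power[of "?F k" N] power_mono[OF factor poly_l1_nonneg, of k N] by linarith
      qed
      also have "\<dots> = 2 ^ (t * d * N * card H)" by (simp add: power_mult)
      finally show ?thesis .
    qed
    ultimately have "poly_l1 ((1 - S i ^ d) ^ m) * poly_l1 (\<Prod>k\<in>H. ?F k ^ N)
        \<le> (1/2) ^ m * 2 ^ (t * d * N * card H)"
      by (intro mult_mono poly_l1_nonneg) auto
    also have "\<dots> = (1/2) ^ d" unfolding m by (simp add: power_add power_divide)
    finally show "poly_l1 (annihilator m N d H x \<circ>\<^sub>p S i ^ d) \<le> (1/2) ^ d"
      unfolding annihilator_pcompose by (rule order_trans[OF poly_l1_mult])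
  qed auto
  finally show ?thesis .
qed

lemma harm_le_1_plus_ln:
  assumes "0 < L" shows "harm L \<le> 1 + ln (real L)"
  using euler_mascheroni_sequence_decreasing[of 1 L] assms by (simp add: harm_def)

text \<open>The polynomial \<open>R (J ^ d)\<close> involves, besides the constant term, only the exponents \<open>d k\<close> with
  \<open>1 \<le> k \<le> L\<close>, whose reciprocals sum to about \<open>ln L / d\<close>. Summability of the gaps bounds the number of blocks with gap above \<open>1 / (9 d)\<close>
  by a multiple of \<open>d\<close>, hence a degree \<open>L\<close> of order \<open>d\<^sup>2\<close> suffices, and \<open>ln L / d\<close> tends to zero.\<close>

lemma sparse_annihilator:
  fixes x :: "nat \<Rightarrow> real"
  assumes x: "0 < \<delta>" "\<And>i. \<delta> \<le> x i" "\<And>i. x i < 1" and \<delta>: "\<delta> < 1"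
    and summ: "summable (\<lambda>i. 1 - x i)" and \<epsilon>: "0 < \<epsilon>"
  obtains d L R where "0 < d" "coeff R 0 = 1" "degree R \<le> L"
    "(\<Sum>k = 1..L. 1 / real (d * k)) \<le> \<epsilon>"
    "\<And>i l j. j < N \<Longrightarrow> cmod (coeff ((R \<circ>\<^sub>p carleson_symbol (complex_of_real (x i)) ^ d)
        * carleson_symbol (complex_of_real (x i)) ^ l) j) \<le> \<epsilon> * 2 ^ l"
proof -
  obtain t :: nat where t: "4 / \<delta> \<le> 2 ^ t"
    using real_arch_pow[of 2 "4 / \<delta>"] less_imp_le by auto
  obtain s :: nat where s: "(\<Sum>i. 1 - x i) \<le> real s" using real_arch_simple by blast
  \<comment> \<open>With \<open>card H \<le> 9 s d\<close>, this constant bounds the degree \<open>m + N * card H\<close> by \<open>C * d ^ 2\<close>.\<close>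
  define C where "C = t * N * (9 * s) + 1 + N * (9 * s)"
  have "(\<lambda>d. (1 + ln (real C * real d ^ 2)) / real d) \<longlonglongrightarrow> 0"
    and "(\<lambda>d. (1/2 :: real) ^ d) \<longlonglongrightarrow> 0"
  proof -
    have "0 < real C" unfolding of_nat_0_less_iff by (simp add: C_def)
    thus "(\<lambda>d. (1 + ln (real C * real d ^ 2)) / real d) \<longlonglongrightarrow> 0" by real_asymp
  qed real_asymp
  hence "\<forall>\<^sub>F d in sequentially. (1 + ln (real C * real d ^ 2)) / real d < \<epsilon> \<and> (1/2) ^ d < \<epsilon> \<and> 0 < d"
    using \<epsilon> by (intro eventually_conj order_tendstoD eventually_gt_at_top) auto
  then obtain d where d: "(1 + ln (real C * real d ^ 2)) / real d < \<epsilon>" "(1/2) ^ d < \<epsilon>" "0 < d"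
    using eventually_happens by force
  define H where "H = {i. 1 / (9 * real d) < 1 - x i}"
  have fin: "finite H"
  proof -
    have "\<forall>\<^sub>F i in sequentially. 1 - x i < 1 / (9 * real d)"
      using summable_LIMSEQ_zero[OF summ] d(3) by (intro order_tendstoD) auto
    then obtain I where "\<And>i. i \<ge> I \<Longrightarrow> 1 - x i < 1 / (9 * real d)" by (auto simp: eventually_sequentially)
    hence "H \<subseteq> {..<I}" unfolding H_def by (metis (mono_tags) lessThan_iff mem_Collect_eq not_le_imp_less order_less_asym subsetI)
    thus ?thesis using finite_subset by blast
  qed
  have card: "card H \<le> 9 * s * d"
  proof -
    have "real (card H) * (1 / (9 * real d)) \<le> (\<Sum>i\<in>H. 1 - x i)"
      by (rule sum_bounded_below) (auto simp: H_def less_imp_le)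
    also have "\<dots> \<le> (\<Sum>i. 1 - x i)" using x(3) by (intro sum_le_suminf summ fin) (auto simp: less_imp_le)
    also have "\<dots> \<le> real s" by (rule s)
    finally have "real (card H) \<le> real (9 * s * d)" using d(3) by (simp add: field_simps)
    thus ?thesis by (simp only: of_nat_le_iff)
  qed
  define m where "m = t * d * N * card H + d"
  define L where "L = C * d ^ 2"
  show thesis
  proof (rule that[of d "annihilator m N d H x" L])
    show "0 < d" by (rule d)
    show "coeff (annihilator m N d H x) 0 = 1" by (rule coeff_annihilator_0)
    have "m + N * card H \<le> t * d * N * (9 * s * d) + d + N * (9 * s * d)"
      unfolding m_def using card by (intro add_mono mult_left_mono) auto
    also have "\<dots> \<le> t * d * N * (9 * s * d) + d * d + N * (9 * s * d) * d"
      using d(3) by (intro add_mono) auto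
    also have "\<dots> = L" by (simp add: L_def C_def power2_eq_square algebra_simps)
    finally show "degree (annihilator m N d H x) \<le> L" using degree_annihilator le_trans by blast
    have L: "0 < L" using d(3) by (simp add: L_def C_def)
    have "(\<Sum>k = 1..L. 1 / real (d * k)) = harm L / real d"
      by (simp add: harm_def sum_divide_distrib inverse_eq_divide mult.commute)
    also have "\<dots> \<le> (1 + ln (real L)) / real d"
      using harm_le_1_plus_ln[OF L] by (intro divide_right_mono) auto
    also have "\<dots> \<le> \<epsilon>" using d(1) by (simp add: L_def)
    finally show "(\<Sum>k = 1..L. 1 / real (d * k)) \<le> \<epsilon>" .
  next
    fix i l j assume "j < N"
    have "cmod (coeff ((annihilator m N d H x \<circ>\<^sub>p carleson_symbol (complex_of_real (x i)) ^ d)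
        * carleson_symbol (complex_of_real (x i)) ^ l) j) \<le> (1/2) ^ d * 2 ^ l"
      by (rule annihilator_small[OF x \<delta> d(3) t _ fin m_def \<open>j < N\<close>]) (auto simp: H_def)
    also have "\<dots> \<le> \<epsilon> * 2 ^ l" using d(2) by (intro mult_right_mono) auto
    finally show "cmod (coeff ((annihilator m N d H x \<circ>\<^sub>p carleson_symbol (complex_of_real (x i)) ^ d)
        * carleson_symbol (complex_of_real (x i)) ^ l) j) \<le> \<epsilon> * 2 ^ l" .
  qed
qed

text \<open>Orthogonality to all but the constant term of \<open>R (J ^ d) J ^ l g\<close> leaves
  \<open>\<langle>h, J ^ l g\<rangle> = \<langle>h, R (J ^ d) J ^ l g\<rangle>\<close>, and the vector on the right is small.\<close>

lemma orthogonal_to_sparse_powers: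
  assumes pos: "\<And>i. 0 < n i" and N: "\<And>i. n i \<le> N"
    and g: "\<And>k. (carleson_op n z ^^ k) g \<in> ell2" and h: "h \<in> ell2"
    and R: "coeff R 0 = 1" "degree R \<le> L" and \<epsilon>: "0 \<le> \<epsilon>"
    and small: "\<And>i j. j < N \<Longrightarrow>
      cmod (coeff ((R \<circ>\<^sub>p carleson_symbol (z i) ^ d) * carleson_symbol (z i) ^ l) j) \<le> \<epsilon>"
    and orth: "\<And>k. k \<in> {1..L} \<Longrightarrow> ell2_inner h ((carleson_op n z ^^ (d * k + l)) g) = 0"
  shows "(cmod (ell2_inner h ((carleson_op n z ^^ l) g)))\<^sup>2
       \<le> ell2_normsq h * ((\<epsilon> * N)\<^sup>2 * ell2_normsq g)"
proof -
  define c where "c i = coeff ((R \<circ>\<^sub>p carleson_symbol (z i) ^ d) * carleson_symbol (z i) ^ l)" for i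
  let ?J = "\<lambda>k. (carleson_op n z ^^ k) g"
  have g0: "g \<in> ell2" using g[of 0] by simp
  have c: "cmod (c i j) \<le> \<epsilon>" if "j < n i" for i j
    using small[of j i] that N[of i] by (simp add: c_def)
  note bounded = block_toeplitz_bounded[of n N c \<epsilon>, OF pos N c \<epsilon> g0]
  have "block_toeplitz n c g = (\<lambda>m. \<Sum>k\<le>degree R. coeff R k * ?J (d * k + l) m)"
    unfolding c_def by (rule ext) (rule block_toeplitz_poly[OF pos])
  hence "ell2_inner h (block_toeplitz n c g)
      = (\<Sum>k\<le>degree R. cnj (coeff R k) * ell2_inner h (?J (d * k + l)))"
    by (simp add: ell2_inner_sum_right[OF h] ell2_inner_scale_right[OF h g] ell2_scale[OF g])
  also have "\<dots> = (\<Sum>k\<le>degree R. if k = 0 then ell2_inner h (?J l) else 0)"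
    using R by (intro sum.cong) (auto intro!: orth)
  also have "\<dots> = ell2_inner h (?J l)" by simp
  finally have "(cmod (ell2_inner h (?J l)))\<^sup>2 \<le> ell2_normsq h * ell2_normsq (block_toeplitz n c g)"
    using ell2_Cauchy_Schwarz[OF h bounded(1)] by simp
  also have "\<dots> \<le> ell2_normsq h * ((\<epsilon> * N)\<^sup>2 * ell2_normsq g)"
    by (intro mult_left_mono bounded(2) ell2_normsq_nonneg h)
  finally show ?thesis .
qed

section \<open>Enumerating a thin union of finite sets\<close>

lemma sum_UN_le:
  fixes f :: "'a \<Rightarrow> real"
  assumes "\<And>a. 0 \<le> f a" "\<And>j. finite (A j)"
  shows "sum f (\<Union>j<J. A j) \<le> (\<Sum>j<(J::nat). sum f (A j))"
proof (induction J)
  case (Suc J)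
  have "sum f (\<Union>j<Suc J. A j) = sum f ((\<Union>j<J. A j) \<union> A J)"
    by (rule arg_cong[of _ _ "sum f"]) (auto simp: less_Suc_eq)
  also have "\<dots> \<le> sum f (\<Union>j<J. A j) + sum f (A J)"
    using sum.union_inter[of "\<Union>j<J. A j" "A J" f] sum_nonneg[of "(\<Union>j<J. A j) \<inter> A J" f] assms by simp
  finally show ?case using Suc by simp
qed simp

text \<open>Every initial piece of the enumeration is finite, hence covered by finitely many of the sets.\<close>

lemma summable_enumerate_thin_union:
  fixes A :: "nat \<Rightarrow> nat set" and f :: "nat \<Rightarrow> real"
  assumes f: "\<And>a. 0 \<le> f a" and A: "\<And>j. finite (A j)" "infinite (\<Union>j. A j)"
    and w: "summable w" "\<And>j. sum f (A j) \<le> w j"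
  shows "summable (\<lambda>k. f (enumerate (\<Union>j. A j) k))"
proof (rule summableI_nonneg_bounded)
  fix K
  let ?S = "\<Union>j. A j"
  let ?P = "enumerate ?S ` {..<K}"
  have w0: "0 \<le> w j" for j by (rule order_trans[OF sum_nonneg w(2)]) (rule f)
  have "\<forall>a\<in>?P. \<exists>j. a \<in> A j" using enumerate_in_set[OF A(2)] by blast
  then obtain b where b: "\<And>a. a \<in> ?P \<Longrightarrow> a \<in> A (b a)" by metis
  define J where "J = Suc (Max (insert 0 (b ` ?P)))"
  have P: "?P \<subseteq> (\<Union>j<J. A j)"
  proof
    fix a assume a: "a \<in> ?P"
    have "b a \<le> Max (insert 0 (b ` ?P))" by (rule Max_ge) (use a in auto)
    hence "b a < J" by (simp add: J_def)
    thus "a \<in> (\<Union>j<J. A j)" using b[OF a] by blast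
  qed
  have "(\<Sum>k<K. f (enumerate ?S k)) = sum f ?P"
    using inj_enumerate[OF A(2)] by (subst sum.reindex) (auto intro: inj_on_subset)
  also have "\<dots> \<le> sum f (\<Union>j<J. A j)" using P A(1) f by (intro sum_mono2) auto
  also have "\<dots> \<le> (\<Sum>j<J. sum f (A j))" by (rule sum_UN_le[OF f A(1)])
  also have "\<dots> \<le> (\<Sum>j<J. w j)" by (intro sum_mono w)
  also have "\<dots> \<le> suminf w" using w0 by (intro sum_le_suminf w) auto
  finally show "(\<Sum>k<K. f (enumerate ?S k)) \<le> suminf w" .
qed (use f in auto)

section \<open>A complete sequence violating the Muentz condition\<close>

text \<open>Stage \<open>j\<close> contributes a finite set of exponents, of total reciprocal weight at most \<open>2 / 2 ^ j\<close>,
  that reproduces \<open>J ^ l g\<close> for every \<open>l \<le> j\<close> up to an error of order \<open>2 ^ l / 4 ^ j\<close>: the progression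
  \<open>d k\<close> serves \<open>g\<close>, and its shift by \<open>l\<close> serves \<open>J ^ l g\<close>. Shifting only lowers the reciprocals.
  The stages may interleave, since a set of natural numbers is enumerated in increasing order anyway.\<close>

theorem sparse_complete_exponents:
  assumes pos: "\<And>i. 0 < n i" and N: "\<And>i. n i \<le> N"
    and z: "\<And>i. z i = complex_of_real (x i)"
    and x: "0 < \<delta>" "\<And>i. \<delta> \<le> x i" "\<And>i. x i < 1" "\<delta> < 1" and summ: "summable (\<lambda>i. 1 - x i)"
    and g: "\<And>k. (carleson_op n z ^^ k) g \<in> ell2"
  obtains S :: "nat set" where "infinite S" "0 \<notin> S" "summable (\<lambda>k. 1 / real (enumerate S k))"
    "\<And>h l. h \<in> ell2 \<Longrightarrow> (\<And>a. a \<in> S \<Longrightarrow> ell2_inner h ((carleson_op n z ^^ a) g) = 0)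
      \<Longrightarrow> ell2_inner h ((carleson_op n z ^^ l) g) = 0"
proof -
  have "\<exists>d L R. 0 < d \<and> coeff R 0 = 1 \<and> degree R \<le> L \<and>
    (\<Sum>k = 1..L. 1 / real (d * k)) \<le> (1/4) ^ j \<and>
    (\<forall>i l r. r < N \<longrightarrow> cmod (coeff ((R \<circ>\<^sub>p carleson_symbol (z i) ^ d)
        * carleson_symbol (z i) ^ l) r) \<le> (1/4) ^ j * 2 ^ l)" for j :: nat
    unfolding z by (rule sparse_annihilator[OF x summ, of "(1/4) ^ j" N]) (simp, blast)
  then obtain d L R where d: "\<And>j. 0 < d j" and R: "\<And>j. coeff (R j) 0 = 1" "\<And>j. degree (R j) \<le> L j"
    and L: "\<And>j. (\<Sum>k = 1..L j. 1 / real (d j * k)) \<le> (1/4) ^ j"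
    and small: "\<And>j i l r. r < N \<Longrightarrow> cmod (coeff ((R j \<circ>\<^sub>p carleson_symbol (z i) ^ d j)
        * carleson_symbol (z i) ^ l) r) \<le> (1/4) ^ j * 2 ^ l"
    by metis
  define B where "B j = (\<Union>l<Suc j. (\<lambda>k. d j * k + l) ` {1..L j})" for j
  \<comment> \<open>The powers of two only serve to make the union visibly infinite; extra exponents cannot hurt.\<close>
  define A where "A j = insert (2 ^ j) (B j)" for j
  define S where "S = (\<Union>j. A j)"
  have fin: "finite (A j)" for j by (simp add: A_def B_def)
  have inf: "infinite S"
  proof -
    have "range (\<lambda>j. 2 ^ j :: nat) \<subseteq> S" by (auto simp: S_def A_def)
    moreover have "infinite (range (\<lambda>j. 2 ^ j :: nat))"
      by (rule range_inj_infinite) (simp add: inj_on_def)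
    ultimately show ?thesis using infinite_super by blast
  qed
  have "0 \<notin> S"
    using d by (auto simp: S_def A_def B_def) (metis less_irrefl)
  moreover have "summable (\<lambda>k. 1 / real (enumerate S k))"
  proof -
    have weight: "(\<Sum>a\<in>A j. 1 / real a) \<le> 2 * (1/2) ^ j" for j
    proof -
      have "(\<Sum>a\<in>A j. 1 / real a) \<le> 1 / real (2 ^ j) + (\<Sum>a\<in>B j. 1 / real a)"
        unfolding A_def by (simp add: sum.insert_if B_def)
      also have "(\<Sum>a\<in>B j. 1 / real a) \<le> (\<Sum>l<Suc j. \<Sum>a\<in>(\<lambda>k. d j * k + l) ` {1..L j}. 1 / real a)"
        unfolding B_def by (rule sum_UN_le) auto
      also have "\<dots> \<le> (\<Sum>l<Suc j. (1/4) ^ j)"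
      proof (rule sum_mono)
        fix l
        have "(\<Sum>a\<in>(\<lambda>k. d j * k + l) ` {1..L j}. 1 / real a) = (\<Sum>k = 1..L j. 1 / real (d j * k + l))"
          using d[of j] by (subst sum.reindex) (auto simp: inj_on_def)
        also have "\<dots> \<le> (\<Sum>k = 1..L j. 1 / real (d j * k))"
          using d[of j] by (intro sum_mono divide_left_mono mult_pos_pos) (auto intro: add_pos_nonneg)
        finally show "(\<Sum>a\<in>(\<lambda>k. d j * k + l) ` {1..L j}. 1 / real a) \<le> (1/4) ^ j" using L[of j] by simp
      qed
      also have "\<dots> = real (Suc j) * (1/4) ^ j" by simp
      also have "\<dots> \<le> 2 ^ j * (1/4) ^ j"
      proof -
        have "Suc j \<le> 2 ^ j" by (simp add: Suc_leI)
        hence "real (Suc j) \<le> 2 ^ j" using of_nat_le_iff[of "Suc j" "2 ^ j", where 'a = real] by simp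
        thus ?thesis by (intro mult_right_mono) auto
      qed
      also have "\<dots> = (1/2) ^ j" by (simp add: power_mult_distrib[symmetric])
      finally show ?thesis by (simp add: power_divide)
    qed
    have "summable (\<lambda>j. 2 * (1/2 :: real) ^ j)" by (intro summable_mult summable_geometric) simp
    from summable_enumerate_thin_union[OF _ fin inf[unfolded S_def] this weight]
    show ?thesis unfolding S_def by simp
  qed
  moreover have "ell2_inner h ((carleson_op n z ^^ l) g) = 0"
    if h: "h \<in> ell2" and orth: "\<And>a. a \<in> S \<Longrightarrow> ell2_inner h ((carleson_op n z ^^ a) g) = 0" for h l
  proof -
    define M where "M = ell2_normsq h * ((2 ^ l * N)\<^sup>2 * ell2_normsq g)"
    have "(cmod (ell2_inner h ((carleson_op n z ^^ l) g)))\<^sup>2 \<le> M * ((1/16) ^ j)" if "j \<ge> l" for j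
    proof -
      have "(cmod (ell2_inner h ((carleson_op n z ^^ l) g)))\<^sup>2
          \<le> ell2_normsq h * (((1/4) ^ j * 2 ^ l * N)\<^sup>2 * ell2_normsq g)"
      proof (rule orthogonal_to_sparse_powers[OF pos N g h R(1) R(2) _ small])
        fix k assume k: "k \<in> {1..L j}"
        have "d j * k + l \<in> B j" unfolding B_def
          by (rule UN_I[of l]) (use k that in \<open>auto intro: imageI\<close>)
        thus "ell2_inner h ((carleson_op n z ^^ (d j * k + l)) g) = 0"
          by (intro orth) (auto simp: S_def A_def)
      qed auto
      also have "\<dots> = M * (((1/4) ^ j)\<^sup>2)" by (simp add: M_def power_mult_distrib mult_ac)
      also have "((1/4 :: real) ^ j)\<^sup>2 = (1/16) ^ j"
        by (simp add: power2_eq_square power_mult_distrib[symmetric])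
      finally show ?thesis .
    qed
    moreover have "(\<lambda>j. M * ((1/16) ^ j)) \<longlonglongrightarrow> 0" by real_asymp
    ultimately have "(cmod (ell2_inner h ((carleson_op n z ^^ l) g)))\<^sup>2 \<le> 0"
      by (intro LIMSEQ_le_const) auto
    thus ?thesis by simp
  qed
  ultimately show thesis using that[of S] inf by blast
qed

theorem theorem1p4:
  fixes n :: "nat \<Rightarrow> nat" and z g :: "nat \<Rightarrow> complex"
  assumes "\<And>i. 0 < n i" and "bdd_above (range n)"
    and "block_diagonal_carleson_frame n z g"
    and "point_spectrum (carleson_op n z) \<subseteq> complex_of_real ` {0<..<1}"
  shows "(\<forall>lam :: nat \<Rightarrow> real.
            strict_mono lam \<and> range lam \<subseteq> {0..} \<and> \<not> summable (\<lambda>k. lam k / ((lam k)\<^sup>2 + 1)) \<longrightarrow>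
            is_complete (\<lambda>k. carleson_op_powr n z (complex_of_real (lam k)) g)) \<and>
         (\<exists>lam :: nat \<Rightarrow> real.
            strict_mono lam \<and> range lam \<subseteq> {0..} \<and> summable (\<lambda>k. lam k / ((lam k)\<^sup>2 + 1)) \<and>
            is_complete (\<lambda>k. carleson_op_powr n z (complex_of_real (lam k)) g))"
proof -
  note pos = assms(1)
  obtain N where N: "\<And>i. n i \<le> N" using assms(2) by (auto simp: bdd_above_def)
  have frame: "is_frame (\<lambda>k. (carleson_op n z ^^ k) g)" and g: "g \<in> ell2"
    using assms(3) by (auto simp: block_diagonal_carleson_frame_def)
  have orbit: "(carleson_op n z ^^ k) g \<in> ell2" for k using frame by (auto simp: is_frame_def)
  have "\<exists>r. z i = complex_of_real r \<and> 0 < r \<and> r < 1" for i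
    using subsetD[OF assms(4) eigenvalue_in_point_spectrum[of n z i, OF pos]] by auto
  then obtain x where z: "\<And>i. z i = complex_of_real (x i)" and x01: "\<And>i. 0 < x i" "\<And>i. x i < 1"
    by metis
  have summ: "summable (\<lambda>i. 1 - x i)" by (rule frame_imp_summable_gap[OF pos z x01 g frame])
  obtain \<delta> where \<delta>: "0 < \<delta>" "\<delta> < 1" "\<And>i. \<delta> \<le> x i"
    using summable_gap_imp_bounded_below[OF summ x01(1)] by blast
  have zne: "z i \<noteq> 0" for i using x01(1)[of i] by (simp add: z)
  have int_powr: "carleson_op_powr n z (complex_of_real (real k)) h = (carleson_op n z ^^ k) h" for k h
    using carleson_op_powr_of_nat[of n z k h, OF pos zne] by simp
  show ?thesis
  proof (intro conjI allI impI)
    fix lam :: "nat \<Rightarrow> real"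
    assume lam: "strict_mono lam \<and> range lam \<subseteq> {0..} \<and> \<not> summable (\<lambda>k. lam k / ((lam k)\<^sup>2 + 1))"
    hence nonneg: "0 \<le> lam k" for k by auto
    have inj: "inj lam" using lam strict_mono_imp_inj_on by blast
    show "is_complete (\<lambda>k. carleson_op_powr n z (complex_of_real (lam k)) g)"
    proof (rule is_complete_if_orthogonal_trivial)
      show "carleson_op_powr n z (complex_of_real (lam k)) g \<in> ell2" for k
        by (rule carleson_op_powr_ell2[of n N z x \<delta>, OF pos N z \<delta>(1,3) x01(2) g nonneg])
      fix u assume u: "u \<in> ell2" "\<And>k. ell2_inner u (carleson_op_powr n z (complex_of_real (lam k)) g) = 0"
      have "ell2_inner u ((carleson_op n z ^^ k) g) = 0" for k
        using muntz_orthogonal[of n N z x \<delta> g u lam "real k", OF pos N z \<delta>(1,3) x01(2) g u(1) inj nonneg _ u(2)]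
          lam by (simp only: int_powr) simp
      thus "u = (\<lambda>m. 0)" by (rule frame_orthogonal_trivial[OF frame u(1)])
    qed
  next
    obtain S where S: "infinite S" "0 \<notin> S" "summable (\<lambda>k. 1 / real (enumerate S k))"
      "\<And>h l. h \<in> ell2 \<Longrightarrow> (\<And>a. a \<in> S \<Longrightarrow> ell2_inner h ((carleson_op n z ^^ a) g) = 0)
        \<Longrightarrow> ell2_inner h ((carleson_op n z ^^ l) g) = 0"
      using sparse_complete_exponents[of n N z x \<delta> g, OF pos N z \<delta>(1,3) x01(2) \<delta>(2) summ orbit] by blast
    define lam where "lam k = real (enumerate S k)" for k
    have lam_pos: "0 < lam k" for k
      using enumerate_in_set[OF S(1), of k] S(2) by (auto simp: lam_def intro: gr0I)
    show "\<exists>lam :: nat \<Rightarrow> real.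
        strict_mono lam \<and> range lam \<subseteq> {0..} \<and> summable (\<lambda>k. lam k / ((lam k)\<^sup>2 + 1)) \<and>
        is_complete (\<lambda>k. carleson_op_powr n z (complex_of_real (lam k)) g)"
    proof (intro exI[of _ lam] conjI)
      show "strict_mono lam"
        using strict_mono_enumerate[OF S(1)] by (auto simp: strict_mono_def lam_def)
      show "range lam \<subseteq> {0..}" by (auto simp: lam_def)
      have "norm (lam k / ((lam k)\<^sup>2 + 1)) \<le> 1 / real (enumerate S k)" for k
      proof -
        have "lam k / ((lam k)\<^sup>2 + 1) \<le> lam k / (lam k)\<^sup>2"
          using lam_pos[of k] by (intro divide_left_mono) (auto intro!: mult_pos_pos add_pos_pos)
        also have "\<dots> = 1 / real (enumerate S k)"
          using lam_pos[of k] by (simp add: power2_eq_square lam_def)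
        finally show ?thesis using lam_pos[of k] by simp
      qed
      thus "summable (\<lambda>k. lam k / ((lam k)\<^sup>2 + 1))"
        by (intro summable_comparison_test'[OF S(3)])
      show "is_complete (\<lambda>k. carleson_op_powr n z (complex_of_real (lam k)) g)"
        unfolding lam_def int_powr
      proof (rule is_complete_if_orthogonal_trivial)
        show "(carleson_op n z ^^ enumerate S k) g \<in> ell2" for k by (rule orbit)
        fix u assume u: "u \<in> ell2" "\<And>k. ell2_inner u ((carleson_op n z ^^ enumerate S k) g) = 0"
        have "ell2_inner u ((carleson_op n z ^^ a) g) = 0" if "a \<in> S" for a
          using enumerate_Ex[OF S(1) that] u(2) by metis
        hence "ell2_inner u ((carleson_op n z ^^ l) g) = 0" for l by (rule S(4)[OF u(1)])
        thus "u = (\<lambda>m. 0)" by (rule frame_orthogonal_trivial[OF frame u(1)])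
      qed
    qed
  qed
qed

end
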